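(* Let $m\ge2$ and $\pmb\mu=(\mu_1,\ldots,\mu_m)$ be an $m$-tuple of finite non-negative Borel measures on $\mathbb T$. If $\mathcal H_{\pmb\mu}=\mathcal H(b)$ as sets for some $b\in H^\infty$ with $\|b\|_\infty\le1$, then $\mu_2=\cdots=\mu_m=0$.
   Context: $\mathbb D$ open unit disc, $\mathbb T$ unit circle, $dA$ normalized area measure, $H^2$ Hardy space, $H^\infty$ bounded holomorphic functions on $\mathbb D$ with sup norm. For a measure $\mu$, $P_\mu(z)=\int_{\mathbb T}\frac{1-|z|^2}{|z-\zeta|^2}d\mu(\zeta)$, $D_{\mu,j}(f)=\frac{1}{j!(j-1)!}\int_{\mathbb D}|f^{(j)}|^2P_\mu(1-|z|^2)^{j-1}dA$ ($j\ge1$), $\mathcal H_{\mu,j}=\{f\in\mathcal O(\mathbb D):D_{\mu,j}(f)<\infty\}$ if $\mu\ne0$ and $H^2$ if $\mu=0$. $\mathcal H_{\pmb\mu}=\bigcap_{j=1}^m\mathcal H_{\mu_j,j}$ with norm $\|f\|^2_{\pmb\mu}=\|f\|_{H^2}^2+\sum_jD_{\mu_j,j}(f)$. For $b$ in the closed unit ball of $H^\infty$, the de Branges–Rovnyak space $\mathcal H(b)$ is the reproducing kernel Hilbert space on $\mathbb D$ with kernel $\frac{1-b(z)\overline{b(w)}}{1-z\overline w}$. *)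

theory Defs
  imports "HOL-Analysis.Analysis"
begin

text \<open>Open unit disc is \<open>ball 0 1\<close>, unit circle is \<open>sphere 0 1\<close>.
  Holomorphic functions on the disc are modelled as total functions \<open>complex \<Rightarrow> complex\<close>;
  all membership predicates below depend only on the values on the disc.\<close>

definition circle_measure :: "complex measure \<Rightarrow> bool" where
  "circle_measure \<mu> \<longleftrightarrow> sets \<mu> = sets borel \<and> finite_measure \<mu> \<and>
     emeasure \<mu> (- sphere 0 1) = 0"

definition H2 :: "(complex \<Rightarrow> complex) set" where
  "H2 = {f. f holomorphic_on ball 0 1 \<and>
      bdd_above ((\<lambda>r. integral {0..2*pi} (\<lambda>t. (cmod (f (complex_of_real r * cis t)))\<^sup>2)) ` {0..<1})}"

definition poisson :: "complex measure \<Rightarrow> complex \<Rightarrow> real" where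
  "poisson \<mu> z = integral\<^sup>L \<mu> (\<lambda>\<zeta>. (1 - (cmod z)\<^sup>2) / (cmod (z - \<zeta>))\<^sup>2)"

text \<open>\<open>D_{\<mu>,j}(f)\<close>, with normalized area measure \<open>dA = dx dy / \<pi>\<close>.\<close>
definition Dint :: "complex measure \<Rightarrow> nat \<Rightarrow> (complex \<Rightarrow> complex) \<Rightarrow> ennreal" where
  "Dint \<mu> j f = (\<integral>\<^sup>+ z. ennreal ((cmod ((deriv ^^ j) f z))\<^sup>2 * poisson \<mu> z
        * (1 - (cmod z)\<^sup>2) ^ (j - 1)) * indicator (ball 0 1) z \<partial>lborel)
        / ennreal (pi * fact j * fact (j - 1))"

definition Hmuj :: "complex measure \<Rightarrow> nat \<Rightarrow> (complex \<Rightarrow> complex) set" where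
  "Hmuj \<mu> j = (if \<mu> = null_measure borel then H2
               else {f. f holomorphic_on ball 0 1 \<and> Dint \<mu> j f < \<infinity>})"

definition Hmu :: "nat \<Rightarrow> (nat \<Rightarrow> complex measure) \<Rightarrow> (complex \<Rightarrow> complex) set" where
  "Hmu m \<mu> = (\<Inter>j\<in>{1..m}. Hmuj (\<mu> j) j)"

text \<open>Reproducing kernel Hilbert space of a kernel \<open>K\<close> on a set \<open>S\<close>, via the
  Moore--Aronszajn construction: finite combinations \<open>\<Sum> c_i K(\<cdot>,w_i)\<close> (lists of
  pairs (c_i, w_i)), with norm \<open>\<Sum>_{i,k} c_i conj(c_k) K(w_k,w_i)\<close>; the space consists
  of pointwise limits on \<open>S\<close> of Cauchy sequences of such combinations.\<close>
definition keval :: "(complex \<Rightarrow> complex \<Rightarrow> complex) \<Rightarrow> (complex \<times> complex) list \<Rightarrow> complex \<Rightarrow> complex" where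
  "keval K xs z = (\<Sum>(c, w)\<leftarrow>xs. c * K z w)"

definition knormsq :: "(complex \<Rightarrow> complex \<Rightarrow> complex) \<Rightarrow> (complex \<times> complex) list \<Rightarrow> real" where
  "knormsq K xs = Re (\<Sum>(c, w)\<leftarrow>xs. \<Sum>(d, v)\<leftarrow>xs. c * cnj d * K v w)"

definition kdiff :: "(complex \<times> complex) list \<Rightarrow> (complex \<times> complex) list \<Rightarrow> (complex \<times> complex) list" where
  "kdiff xs ys = xs @ map (\<lambda>(c, w). (- c, w)) ys"

definition rkhs :: "(complex \<Rightarrow> complex \<Rightarrow> complex) \<Rightarrow> complex set \<Rightarrow> (complex \<Rightarrow> complex) set" where
  "rkhs K S = {f. \<exists>g :: nat \<Rightarrow> (complex \<times> complex) list.
      (\<forall>n. \<forall>(c, w)\<in>set (g n). w \<in> S) \<and>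
      (\<forall>e>0. \<exists>N. \<forall>n\<ge>N. \<forall>k\<ge>N. knormsq K (kdiff (g n) (g k)) < e) \<and>
      (\<forall>z\<in>S. (\<lambda>n. keval K (g n) z) \<longlonglongrightarrow> f z)}"

definition dBR_kernel :: "(complex \<Rightarrow> complex) \<Rightarrow> complex \<Rightarrow> complex \<Rightarrow> complex" where
  "dBR_kernel b z w = (1 - b z * cnj (b w)) / (1 - z * cnj w)"

definition dBR :: "(complex \<Rightarrow> complex) \<Rightarrow> (complex \<Rightarrow> complex) set" where
  "dBR b = rkhs (dBR_kernel b) (ball 0 1)"

end

theory Submission
  imports Defs "HOL-Complex_Analysis.Complex_Analysis"
begin

text \<open>
  If \<open>\<mu>\<^sub>j \<noteq> 0\<close> for some \<open>j \<ge> 2\<close>, then \<open>P\<^bsub>\<mu>\<^esub>(z)\<close> is at least a constant times \<open>1 - |z|\<^sup>2\<close>, and the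
  mean value property turns \<open>D\<^bsub>\<mu>,j\<^esub>(f) < \<infinity>\<close> into the growth bound \<open>|f(w)| = O((1 - |w|) powr (-1/4))\<close>
  for every \<open>f\<close> in the space. In \<open>H(b)\<close> the normalised kernel function at \<open>w\<close> has at \<open>w\<close> the value \<open>((1 - |b(w)|\<^sup>2) / (1 - |w|\<^sup>2)) powr (1/2)\<close>, so a gliding hump argument shows
  that this growth is possible only if \<open>|b(w)| \<longlongrightarrow> 1\<close> uniformly as \<open>|w| \<longlongrightarrow> 1\<close>. Then \<open>b\<close> is a finite
  Blaschke product, its kernel has finite rank and \<open>H(b)\<close> is finite dimensional. But the
  weighted spaces contain all polynomials.
\<close>

section \<open>Area integrals and rotations\<close>

text \<open>Only the two sets are assumed equal. No norms are compared, so each function comes with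
  its own constant \<open>C\<close> in the growth bound, and the hump must yield a single function
  that defeats every constant. The exponent is what separates j = 1 from j >= 2. Mean values over
  discs of radius (1 - |w|)/2 bound the j-th derivative by (1 - |w|) to the power -(j/2 + 1), and j
  integrations along radii leave 1 - j/2 as the growth exponent of f. For j = 1 this is 1/2, a
  growth that normalised kernels of H(b) can have anyway, and no contradiction results. For j >= 2
  it is at most 0, up to a logarithm when j = 2; the value 1/4 is a convenient choice strictly
  between 0 and 1/2. That the hump lies in H(b) rests on |K(z,w)|^2 <= K(z,z) K(w,w) for the kernel,
  which is the Schwarz-Pick inequality in disguise.\<close>

lemma lborel_complex_eq_distr:
  "lborel = distr (lborel \<Otimes>\<^sub>M lborel) borel (\<lambda>(x, y). Complex x y)"
proof (rule lborel_eqI)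
  have m: "(\<lambda>(x, y). Complex x y) \<in> borel_measurable (borel \<Otimes>\<^sub>M borel)"
    unfolding Complex_eq by measurable
  fix l u :: complex
  assume le: "\<And>b. b \<in> Basis \<Longrightarrow> l \<bullet> b \<le> u \<bullet> b"
  have re: "Re l \<le> Re u" "Im l \<le> Im u"
    using le[of 1] le[of \<i>] by (auto simp: Basis_complex_def)
  have pre: "(\<lambda>(x, y). Complex x y) -` box l u \<inter> space (lborel \<Otimes>\<^sub>M lborel)
      = box (Re l) (Re u) \<times> box (Im l) (Im u)"
    by (auto simp: space_pair_measure in_box_complex_iff)
  have "emeasure (distr (lborel \<Otimes>\<^sub>M lborel) borel (\<lambda>(x, y). Complex x y)) (box l u)
     = emeasure (lborel \<Otimes>\<^sub>M lborel) (box (Re l) (Re u) \<times> box (Im l) (Im u))"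
    using m by (subst emeasure_distr) (auto simp: pre)
  also have "\<dots> = ennreal (Re u - Re l) * ennreal (Im u - Im l)"
    using re by (subst lborel.emeasure_pair_measure_Times) auto
  also have "\<dots> = ennreal (\<Prod>b\<in>Basis. (u - l) \<bullet> b)"
    using re by (simp add: Basis_complex_def ennreal_mult)
  finally show "emeasure (distr (lborel \<Otimes>\<^sub>M lborel) borel (\<lambda>(x, y). Complex x y)) (box l u)
     = ennreal (\<Prod>b\<in>Basis. (u - l) \<bullet> b)" .
qed simp

lemma Complex_measurable [measurable]:
  "case_prod Complex \<in> borel_measurable (borel \<Otimes>\<^sub>M borel)"
  unfolding Complex_eq by measurable

lemma nn_integral_lborel_complex:
  fixes h :: "complex \<Rightarrow> ennreal"
  assumes [measurable]: "h \<in> borel_measurable borel"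
  shows "(\<integral>\<^sup>+z. h z \<partial>lborel) = (\<integral>\<^sup>+x. \<integral>\<^sup>+y. h (Complex x y) \<partial>lborel \<partial>lborel)"
    and "(\<integral>\<^sup>+z. h z \<partial>lborel) = (\<integral>\<^sup>+y. \<integral>\<^sup>+x. h (Complex x y) \<partial>lborel \<partial>lborel)"
proof -
  have m: "case_prod Complex \<in> measurable (lborel \<Otimes>\<^sub>M lborel) borel"
    by measurable
  have *: "(\<integral>\<^sup>+z. h z \<partial>lborel) = (\<integral>\<^sup>+p. h (case_prod Complex p) \<partial>(lborel \<Otimes>\<^sub>M lborel))"
    by (subst lborel_complex_eq_distr) (simp add: nn_integral_distr[OF m])
  have hm: "(\<lambda>p. h (case_prod Complex p)) \<in> borel_measurable (lborel \<Otimes>\<^sub>M lborel)"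
    by measurable
  show "(\<integral>\<^sup>+z. h z \<partial>lborel) = (\<integral>\<^sup>+x. \<integral>\<^sup>+y. h (Complex x y) \<partial>lborel \<partial>lborel)"
    unfolding * using lborel.nn_integral_fst[OF hm] by simp
  show "(\<integral>\<^sup>+z. h z \<partial>lborel) = (\<integral>\<^sup>+y. \<integral>\<^sup>+x. h (Complex x y) \<partial>lborel \<partial>lborel)"
    unfolding * using lborel_pair.nn_integral_snd[OF hm] by simp
qed

lemma nn_integral_lborel_shift:
  fixes h :: "real \<Rightarrow> ennreal"
  assumes [measurable]: "h \<in> borel_measurable borel"
  shows "(\<integral>\<^sup>+x. h (x + a) \<partial>lborel) = (\<integral>\<^sup>+x. h x \<partial>lborel)"
  using nn_integral_real_affine[of h 1 a] assms by (simp add: add.commute)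

text \<open>A shear translates each horizontal (or each vertical) line, so integrating along those
  lines first reduces the claim to translation invariance on the real line.\<close>

lemma nn_integral_shear:
  fixes h :: "complex \<Rightarrow> ennreal"
  assumes [measurable]: "h \<in> borel_measurable borel"
  shows "(\<integral>\<^sup>+z. h (Complex (Re z + a * Im z) (Im z)) \<partial>lborel) = (\<integral>\<^sup>+z. h z \<partial>lborel)"
    and "(\<integral>\<^sup>+z. h (Complex (Re z) (Im z + a * Re z)) \<partial>lborel) = (\<integral>\<^sup>+z. h z \<partial>lborel)"
proof -
  have [measurable]: "(\<lambda>z. h (Complex (Re z + a * Im z) (Im z))) \<in> borel_measurable borel"
     "(\<lambda>z. h (Complex (Re z) (Im z + a * Re z))) \<in> borel_measurable borel"
    unfolding Complex_eq by measurable
  have [measurable]: "(\<lambda>x. h (Complex x y)) \<in> borel_measurable borel" 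
    "(\<lambda>x. h (Complex y x)) \<in> borel_measurable borel" for y
    unfolding Complex_eq by measurable
  have "(\<integral>\<^sup>+x. h (Complex (x + a * y) y) \<partial>lborel) = (\<integral>\<^sup>+x. h (Complex x y) \<partial>lborel)" for y
    by (rule nn_integral_lborel_shift) measurable
  then show "(\<integral>\<^sup>+z. h (Complex (Re z + a * Im z) (Im z)) \<partial>lborel) = (\<integral>\<^sup>+z. h z \<partial>lborel)"
    by (simp add: nn_integral_lborel_complex(2))
  have "(\<integral>\<^sup>+y. h (Complex x (y + a * x)) \<partial>lborel) = (\<integral>\<^sup>+y. h (Complex x y) \<partial>lborel)" for x
    by (rule nn_integral_lborel_shift) measurable
  then show "(\<integral>\<^sup>+z. h (Complex (Re z) (Im z + a * Re z)) \<partial>lborel) = (\<integral>\<^sup>+z. h z \<partial>lborel)"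
    by (simp add: nn_integral_lborel_complex(1))
qed

text \<open>A rotation by \<open>c\<close> with \<open>Re c \<ge> 0\<close> is a product of three shears, and every rotation is the
  square of such a one.\<close>
lemma nn_integral_rotate:
  fixes h :: "complex \<Rightarrow> ennreal"
  assumes "h \<in> borel_measurable borel" "cmod c = 1"
  shows "(\<integral>\<^sup>+z. h (c * z) \<partial>lborel) = (\<integral>\<^sup>+z. h z \<partial>lborel)"
proof -
  have half: "(\<integral>\<^sup>+z. h (c * z) \<partial>lborel) = (\<integral>\<^sup>+z. h z \<partial>lborel)"
    if [measurable]: "h \<in> borel_measurable borel" and c: "cmod c = 1" "Re c \<ge> 0"
    for h :: "complex \<Rightarrow> ennreal" and c
  proof -
    \<comment> \<open>For \<open>c = cis \<theta>\<close> this is -tan(\<theta>/2): the rotation is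
      the horizontal shear by \<open>a\<close>, then the vertical shear by sin \<theta>, then the
      horizontal shear by \<open>a\<close> again. \<open>Re c \<ge> 0\<close> keeps the denominator
      positive.\<close>
    define a where "a = - Im c / (1 + Re c)"
    have c1: "(Re c)\<^sup>2 + (Im c)\<^sup>2 = 1" using c by (simp add: cmod_def)
    have i1: "1 + a * Im c = Re c" and i2: "2 * a + a * a * Im c = - Im c"
    proof -
      have ay: "a * (1 + Re c) = - Im c" using c by (simp add: a_def)
      have "(1 + a * Im c) * (1 + Re c) = (1 + Re c) + (a * (1 + Re c)) * Im c"
        by (simp add: algebra_simps)
      also have "\<dots> = Re c * (1 + Re c)"
        unfolding ay using c1 by (simp add: algebra_simps power2_eq_square)
      finally show 1: "1 + a * Im c = Re c" using c by simp
      have "2 * a + a * a * Im c = a * (1 + (1 + a * Im c))" by (simp add: algebra_simps)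
      then show "2 * a + a * a * Im c = - Im c" unfolding 1 by (simp add: ay)
    qed
    define s where "s z = Complex (Re z + a * Im z) (Im z)" for z
    define t where "t z = Complex (Re z) (Im z + Im c * Re z)" for z
    have [measurable]: "s \<in> borel_measurable borel" "t \<in> borel_measurable borel"
      unfolding s_def t_def Complex_eq by measurable
    have "c * z = s (t (s z))" for z
    proof (rule complex_eqI)
      have "Re (s (t (s z))) = (1 + a * Im c) * Re z + (2 * a + a * a * Im c) * Im z"
        by (simp add: s_def t_def algebra_simps)
      then show "Re (c * z) = Re (s (t (s z)))" unfolding i1 i2 by simp
      have "Im (s (t (s z))) = (1 + a * Im c) * Im z + Im c * Re z"
        by (simp add: s_def t_def algebra_simps)
      then show "Im (c * z) = Im (s (t (s z)))" unfolding i1 by simp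
    qed
    then have "(\<integral>\<^sup>+z. h (c * z) \<partial>lborel) = (\<integral>\<^sup>+z. h (s (t (s z))) \<partial>lborel)" by simp
    also have "\<dots> = (\<integral>\<^sup>+z. h (s (t z)) \<partial>lborel)"
      using nn_integral_shear(1)[of "\<lambda>z. h (s (t z))" a] by (simp flip: s_def)
    also have "\<dots> = (\<integral>\<^sup>+z. h (s z) \<partial>lborel)"
      using nn_integral_shear(2)[of "\<lambda>z. h (s z)" "Im c"] by (simp flip: t_def)
    also have "\<dots> = (\<integral>\<^sup>+z. h z \<partial>lborel)"
      using nn_integral_shear(1)[of h a] by (simp flip: s_def)
    finally show ?thesis .
  qed
  define d where "d = csqrt c"
  have d: "d * d = c" using power2_csqrt[of c] by (simp add: d_def power2_eq_square)
  have "cmod d = 1"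
    using assms(2) by (simp add: d_def norm_csqrt)
  moreover have "Re d \<ge> 0"
    using csqrt_principal[of c] by (auto simp: d_def simp del: csqrt.sel)
  ultimately show ?thesis
    using half[of "\<lambda>z. h (d * z)" d] half[of h d] assms(1) d by (simp flip: mult.assoc)
qed

section \<open>Mean values over circles and discs\<close>

text \<open>Cauchy's formula on \<open>circlepath w r\<close>: the derivative of the parametrisation
  cancels the factor \<open>1/(u-w)\<close> up to the constant \<i>.\<close>

lemma circle_mean_value:
  fixes f :: "complex \<Rightarrow> complex"
  assumes "f holomorphic_on ball w R" "r < R" "0 \<le> r"
  shows "((\<lambda>t. f (w + of_real r * cis t)) has_integral 2 * pi * f w) {0..2*pi}"
proof (cases "r = 0")
  case True
  then show ?thesis using has_integral_const_real[of "f w" 0 "2*pi"] by (simp add: scaleR_conv_of_real)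
next
  case False
  with assms have r: "r > 0" by auto
  have "f holomorphic_on cball w r"
    by (rule holomorphic_on_subset[OF assms(1)]) (use assms in auto)
  then have "((\<lambda>u. f u/(u-w)) has_contour_integral (2 * of_real pi * \<i> * f w)) (circlepath w r)"
    by (rule Cauchy_integral_circlepath_simple) (use r in auto)
  then have "((\<lambda>t. f (w + r * cis t) / (r * cis t) * r * \<i> * cis t) has_integral (2 * of_real pi * \<i> * f w)) {0..2*pi}"
    unfolding circlepath_def by (subst (asm) has_contour_integral_part_circlepath_iff) auto
  then have "((\<lambda>t. \<i> * f (w + r * cis t)) has_integral (2 * of_real pi * \<i> * f w)) {0..2*pi}"
    by (rule has_integral_eq[rotated]) (use r in auto)
  from has_integral_mult_right[OF this, of "-\<i>"] show ?thesis
    by (simp add: algebra_simps)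
qed

lemma nn_integral_circle:
  fixes \<phi> :: "real \<Rightarrow> real"
  assumes "continuous_on UNIV \<phi>" "\<And>t. 0 \<le> \<phi> t" "(\<phi> has_integral I) {0..2*pi}"
  shows "(\<integral>\<^sup>+t. ennreal (\<phi> t) * indicator {0..2*pi} t \<partial>lborel) = ennreal I"
proof -
  have [measurable]: "\<phi> \<in> borel_measurable borel"
    by (rule borel_measurable_continuous_onI[OF assms(1)])
  have "(\<lambda>t. \<phi> t * indicator {0..2*pi} t) = (\<lambda>t. if t \<in> {0..2*pi} then \<phi> t else 0)"
    by auto
  then have "((\<lambda>t. \<phi> t * indicator {0..2*pi} t) has_integral I) UNIV"
    using has_integral_restrict_UNIV[of "{0..2*pi}" \<phi> I] assms(3) by simp
  then have "(\<integral>\<^sup>+t. ennreal (\<phi> t * indicator {0..2*pi} t) \<partial>lborel) = ennreal I"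
    by (intro nn_integral_has_integral_lborel) (auto simp: assms(2))
  moreover have "ennreal (\<phi> t * indicator {0..2*pi} t) = ennreal (\<phi> t) * indicator {0..2*pi} t" for t
    by (simp add: indicator_def)
  ultimately show ?thesis by simp
qed

text \<open>Rotation invariance averaged over the angle. This plays the role of polar coordinates:
  an estimate or identity for circular means passes to the area integral.\<close>

lemma rotation_average:
  fixes h :: "complex \<Rightarrow> ennreal"
  assumes [measurable]: "h \<in> borel_measurable borel"
  shows "ennreal (2*pi) * (\<integral>\<^sup>+z. h z \<partial>lborel)
     = (\<integral>\<^sup>+z. (\<integral>\<^sup>+t. h (cis t * z) * indicator {0..2*pi} t \<partial>lborel) \<partial>lborel)"
proof -
  have [measurable]: "cis \<in> borel_measurable borel"
    by (intro borel_measurable_continuous_onI continuous_intros)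
  have "(\<integral>\<^sup>+z. (\<integral>\<^sup>+t. h (cis t * z) * indicator {0..2*pi} t \<partial>lborel) \<partial>lborel)
     = (\<integral>\<^sup>+t. (\<integral>\<^sup>+z. h (cis t * z) * indicator {0..2*pi} t \<partial>lborel) \<partial>(lborel :: real measure))"
    by (rule lborel_pair.Fubini') measurable
  also have "\<dots> = (\<integral>\<^sup>+t. (\<integral>\<^sup>+z. h z \<partial>lborel) * indicator {0..2*pi} t \<partial>lborel)"
    by (simp add: nn_integral_multc nn_integral_rotate)
  also have "\<dots> = (\<integral>\<^sup>+z. h z \<partial>lborel) * ennreal (2*pi)"
    by (simp add: nn_integral_cmult)
  finally show ?thesis by (simp add: mult.commute)
qed

lemma cmod_square_indicator_measurable:
  fixes g :: "complex \<Rightarrow> complex"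
  assumes "continuous_on (ball w R) g"
  shows "(\<lambda>z. ennreal ((cmod (g z))\<^sup>2) * indicator (ball w R) z) \<in> borel_measurable borel"
proof -
  have [measurable]: "(\<lambda>z. indicator (ball w R) z *\<^sub>R g z) \<in> borel_measurable borel"
    by (rule borel_measurable_continuous_on_indicator[OF _ assms]) simp
  have eq: "ennreal ((cmod (g z))\<^sup>2) * indicator (ball w R) z
      = ennreal ((cmod (indicator (ball w R) z *\<^sub>R g z))\<^sup>2)" for z
    by (simp add: indicator_def)
  show ?thesis unfolding eq by measurable
qed

text \<open>Subharmonicity of |g|^2: the mean value property of the holomorphic function g^2 and the
  triangle inequality compare |g(w)|^2 with every circular mean about \<open>w\<close>, and
  \<open>rotation_average\<close> collects the circles into the disc.\<close>

lemma submean_value: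
  assumes g: "g holomorphic_on ball w R" and R: "0 < R"
  shows "ennreal (pi * R\<^sup>2 * (cmod (g w))\<^sup>2)
     \<le> (\<integral>\<^sup>+z. ennreal ((cmod (g z))\<^sup>2) * indicator (ball w R) z \<partial>lborel)"
proof -
  define h where "h z = ennreal ((cmod (g (w + z)))\<^sup>2) * indicator (ball 0 R) z" for z
  have gc: "continuous_on (ball w R) g"
    using g by (rule holomorphic_on_imp_continuous_on)
  have gm [measurable]: "(\<lambda>z. ennreal ((cmod (g z))\<^sup>2) * indicator (ball w R) z) \<in> borel_measurable borel"
    using gc by (rule cmod_square_indicator_measurable)
  have h_alt: "h z = (\<lambda>z. ennreal ((cmod (g z))\<^sup>2) * indicator (ball w R) z) (w + z)" for z
    by (simp add: h_def indicator_def dist_norm)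
  have hm [measurable]: "h \<in> borel_measurable borel"
    unfolding h_alt[abs_def] by measurable
  have shift: "(\<integral>\<^sup>+z. h z \<partial>lborel) = (\<integral>\<^sup>+z. ennreal ((cmod (g z))\<^sup>2) * indicator (ball w R) z \<partial>lborel)"
  proof -
    have "(\<integral>\<^sup>+z. ennreal ((cmod (g z))\<^sup>2) * indicator (ball w R) z \<partial>lborel)
      = (\<integral>\<^sup>+z. ennreal ((cmod (g z))\<^sup>2) * indicator (ball w R) z \<partial>(distr lborel borel ((+) w)))"
      by (simp only: lborel_distr_plus)
    also have "\<dots> = (\<integral>\<^sup>+z. h z \<partial>lborel)"
      by (subst nn_integral_distr) (simp_all add: h_alt[THEN ext])
    finally show ?thesis by simp
  qed
  have circ: "ennreal (2 * pi * (cmod (g w))\<^sup>2) * indicator (ball 0 R) z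
      \<le> (\<integral>\<^sup>+t. h (cis t * z) * indicator {0..2*pi} t \<partial>lborel)" for z
  proof (cases "z \<in> ball 0 R")
    case False
    then show ?thesis by simp
  next
    case True
    \<comment> \<open>The unit circle must lie strictly inside a disc on which u \<mapsto> g(w + z
      u) is holomorphic. This radius exceeds 1, satisfies \<open>cmod z * \<rho> < R\<close>, and
      makes sense for \<open>z = 0\<close> too, unlike R/|z|.\<close>
    define \<rho> where "\<rho> = 1 + (R - cmod z) / (2 * R)"
    have zR: "cmod z < R" using True by simp
    have \<rho>: "1 < \<rho>" using zR R by (simp add: \<rho>_def)
    have \<rho>z: "cmod z * \<rho> < R"
    proof -
      have "cmod z * \<rho> = cmod z + (cmod z / R) * ((R - cmod z) / 2)"
        using R by (simp add: \<rho>_def field_simps)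
      also have "\<dots> \<le> cmod z + 1 * ((R - cmod z) / 2)"
        using zR R by (intro add_left_mono mult_right_mono) auto
      also have "\<dots> < R" using zR by (simp add: field_simps)
      finally show ?thesis .
    qed
    have img: "w + z * u \<in> ball w R" if "u \<in> ball 0 \<rho>" for u
    proof -
      have "cmod z * cmod u \<le> cmod z * \<rho>" using that by (intro mult_left_mono) auto
      then show ?thesis using \<rho>z by (simp add: dist_norm norm_mult)
    qed
    have "(\<lambda>u. g (w + z * u)) holomorphic_on ball 0 \<rho>"
    proof (rule holomorphic_on_compose_gen[of "\<lambda>u. w + z * u" "ball 0 \<rho>" g "ball w R", unfolded o_def])
      show "(\<lambda>u. w + z * u) holomorphic_on ball 0 \<rho>" by (intro holomorphic_intros)
    qed (use g img in blast)+
    then have "(\<lambda>u. (g (w + z * u))\<^sup>2) holomorphic_on ball 0 \<rho>"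
      by (intro holomorphic_intros)
    from circle_mean_value[OF this, of 1] \<rho>
    have mv: "((\<lambda>t. (g (w + z * cis t))\<^sup>2) has_integral 2 * pi * (g w)\<^sup>2) {0..2*pi}" by simp
    have c0: "continuous_on UNIV (\<lambda>t. g (w + z * cis t))"
      by (rule continuous_on_compose2[OF gc]) (use img \<rho> in \<open>auto intro!: continuous_intros\<close>)
    then have c1: "continuous_on UNIV (\<lambda>t. (cmod (g (w + z * cis t)))\<^sup>2)"
      by (intro continuous_intros)
    then have "continuous_on {0..2*pi} (\<lambda>t. (cmod (g (w + z * cis t)))\<^sup>2)"
      by (rule continuous_on_subset) simp
    then have int: "(\<lambda>t. (cmod (g (w + z * cis t)))\<^sup>2) integrable_on {0..2*pi}"
      by (rule integrable_continuous_interval)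
    have "cmod (integral {0..2*pi} (\<lambda>t. (g (w + z * cis t))\<^sup>2))
        \<le> integral {0..2*pi} (\<lambda>t. (cmod (g (w + z * cis t)))\<^sup>2)"
      by (rule integral_norm_bound_integral[OF has_integral_integrable[OF mv] int])
         (simp add: norm_power)
    then have le: "2 * pi * (cmod (g w))\<^sup>2 \<le> integral {0..2*pi} (\<lambda>t. (cmod (g (w + z * cis t)))\<^sup>2)"
      unfolding integral_unique[OF mv] by (simp add: norm_mult norm_power)
    have "(\<integral>\<^sup>+t. h (cis t * z) * indicator {0..2*pi} t \<partial>lborel)
       = (\<integral>\<^sup>+t. ennreal ((cmod (g (w + z * cis t)))\<^sup>2) * indicator {0..2*pi} t \<partial>lborel)"
      using zR by (intro nn_integral_cong) (simp add: h_def norm_mult mult.commute)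
    also have "\<dots> = ennreal (integral {0..2*pi} (\<lambda>t. (cmod (g (w + z * cis t)))\<^sup>2))"
      by (rule nn_integral_circle[OF c1 _ integrable_integral[OF int]]) simp
    finally show ?thesis using True le by (simp add: ennreal_leI)
  qed
  have ball: "emeasure lborel (ball (0::complex) R) = ennreal (pi * R\<^sup>2)"
    using R emeasure_ball[of R "0::complex"] by (simp add: eval_unit_ball_vol)
  have "ennreal (2*pi) * ennreal (pi * R\<^sup>2 * (cmod (g w))\<^sup>2)
      = ennreal (2 * pi * (cmod (g w))\<^sup>2) * emeasure lborel (ball (0::complex) R)"
    unfolding ball by (simp add: ennreal_mult[symmetric] mult_ac)
  also have "\<dots> = (\<integral>\<^sup>+z. ennreal (2 * pi * (cmod (g w))\<^sup>2) * indicator (ball 0 R) z \<partial>(lborel::complex measure))"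
    by (rule nn_integral_cmult_indicator[symmetric]) simp
  also have "\<dots> \<le> (\<integral>\<^sup>+z. (\<integral>\<^sup>+t. h (cis t * z) * indicator {0..2*pi} t \<partial>lborel) \<partial>lborel)"
    by (intro nn_integral_mono circ)
  also have "\<dots> = ennreal (2*pi) * (\<integral>\<^sup>+z. h z \<partial>lborel)"
    by (rule rotation_average[symmetric]) simp
  finally show ?thesis
    unfolding shift by (subst (asm) ennreal_mult_le_mult_iff) auto
qed

text \<open>The Poisson kernel is the real part of (\<zeta> + v)/(\<zeta> - v), which is holomorphic
  in v on the disc and equals 1 at v = 0; so its circular means are 1.\<close>

lemma poisson_circle_mean:
  fixes z \<zeta> :: complex
  assumes "cmod z < 1" "cmod \<zeta> = 1"
  shows "(\<integral>\<^sup>+t. ennreal ((1 - (cmod z)\<^sup>2) / (cmod (cis t * z - \<zeta>))\<^sup>2) * indicator {0..2*pi} t \<partial>lborel)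
      = ennreal (2 * pi)"
proof -
  define \<rho> where "\<rho> = 1 + (1 - cmod z) / 2"
  have \<rho>: "1 < \<rho>" using assms by (simp add: \<rho>_def)
  have \<rho>z: "cmod z * \<rho> < 1"
  proof -
    have "cmod z * \<rho> = cmod z + cmod z * ((1 - cmod z) / 2)"
      by (simp add: \<rho>_def field_simps)
    also have "\<dots> \<le> cmod z + 1 * ((1 - cmod z) / 2)"
      using assms by (intro add_left_mono mult_right_mono) auto
    also have "\<dots> < 1" using assms(1) by (simp add: field_simps)
    finally show ?thesis .
  qed
  have ne: "\<zeta> - z * u \<noteq> 0" if "cmod u < \<rho>" for u
  proof -
    have "cmod z * cmod u \<le> cmod z * \<rho>" using that by (intro mult_left_mono) auto
    then have "cmod (z * u) < 1" using \<rho>z by (simp add: norm_mult)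
    then show ?thesis using assms(2) by auto
  qed
  have "(\<lambda>u. (\<zeta> + z * u) / (\<zeta> - z * u)) holomorphic_on ball 0 \<rho>"
    using ne by (intro holomorphic_intros) auto
  from circle_mean_value[OF this, of 1] \<rho>
  have "((\<lambda>t. (\<zeta> + z * cis t) / (\<zeta> - z * cis t)) has_integral 2 * pi * (\<zeta> / \<zeta>)) {0..2*pi}" by simp
  from has_integral_linear[OF this bounded_linear_Re]
  have "((\<lambda>t. Re ((\<zeta> + z * cis t) / (\<zeta> - z * cis t))) has_integral 2 * pi) {0..2*pi}"
    using assms(2) by (cases "\<zeta> = 0") (auto simp: o_def)
  moreover have "Re ((\<zeta> + z * cis t) / (\<zeta> - z * cis t)) = (1 - (cmod z)\<^sup>2) / (cmod (cis t * z - \<zeta>))\<^sup>2" for t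
  proof -
    define v where "v = z * cis t"
    have "cmod v = cmod z" by (simp add: v_def norm_mult)
    moreover have "Re ((\<zeta> + v) / (\<zeta> - v)) = ((cmod \<zeta>)\<^sup>2 - (cmod v)\<^sup>2) / (cmod (\<zeta> - v))\<^sup>2"
      by (simp add: Re_divide cmod_power2) (simp add: algebra_simps power2_eq_square)
    ultimately show ?thesis 
      using assms(2) by (simp add: v_def norm_minus_commute mult.commute)
  qed
  ultimately have hi: "((\<lambda>t. (1 - (cmod z)\<^sup>2) / (cmod (cis t * z - \<zeta>))\<^sup>2) has_integral 2 * pi) {0..2*pi}"
    by simp
  have "continuous_on UNIV (\<lambda>t. (1 - (cmod z)\<^sup>2) / (cmod (cis t * z - \<zeta>))\<^sup>2)"
  proof (intro continuous_intros ballI)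
    fix t :: real
    show "(cmod (cis t * z - \<zeta>))\<^sup>2 \<noteq> 0"
      using ne[of "cis t"] \<rho> by (auto simp: mult.commute)
  qed
  moreover have "0 \<le> (1 - (cmod z)\<^sup>2) / (cmod (cis t * z - \<zeta>))\<^sup>2" for t
    using assms(1) by (simp add: power_le_one)
  ultimately show ?thesis by (rule nn_integral_circle[OF _ _ hi])
qed

section \<open>Poisson integrals and the weighted spaces\<close>

lemma circle_measure_AE:
  assumes "circle_measure \<mu>"
  shows "AE \<zeta> in \<mu>. cmod \<zeta> = 1"
proof (rule AE_I)
  show "{\<zeta> \<in> space \<mu>. \<not> cmod \<zeta> = 1} \<subseteq> - sphere 0 1" by auto
  show "emeasure \<mu> (- sphere 0 1) = 0" using assms by (simp add: circle_measure_def)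
  show "- sphere 0 1 \<in> sets \<mu>" using assms by (simp add: circle_measure_def)
qed

lemma poisson_kernel_bounds:
  assumes z: "cmod z < 1" and \<zeta>: "cmod \<zeta> = 1"
  shows "(1 - (cmod z)\<^sup>2) / 4 \<le> (1 - (cmod z)\<^sup>2) / (cmod (z - \<zeta>))\<^sup>2"
    and "(1 - (cmod z)\<^sup>2) / (cmod (z - \<zeta>))\<^sup>2 \<le> (1 - (cmod z)\<^sup>2) / (1 - cmod z)\<^sup>2"
proof -
  have p: "1 - (cmod z)\<^sup>2 \<ge> 0" using z by (simp add: power_le_one)
  have l: "1 - cmod z \<le> cmod (z - \<zeta>)"
    using norm_triangle_ineq3[of \<zeta> z] \<zeta> by (simp add: norm_minus_commute)
  have u: "cmod (z - \<zeta>) \<le> 2"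
    using norm_triangle_ineq4[of z \<zeta>] \<zeta> z by simp
  have "(cmod (z - \<zeta>))\<^sup>2 \<le> 2\<^sup>2" using u by (intro power_mono) auto
  moreover have "(cmod (z - \<zeta>))\<^sup>2 > 0" using l z by auto
  ultimately show "(1 - (cmod z)\<^sup>2) / 4 \<le> (1 - (cmod z)\<^sup>2) / (cmod (z - \<zeta>))\<^sup>2"
    using p by (intro divide_left_mono) auto
  have "(1 - cmod z)\<^sup>2 \<le> (cmod (z - \<zeta>))\<^sup>2" using l z by (intro power_mono) auto
  moreover have "0 < (cmod (z - \<zeta>))\<^sup>2 * (1 - cmod z)\<^sup>2" using z l by (intro mult_pos_pos) auto
  ultimately show "(1 - (cmod z)\<^sup>2) / (cmod (z - \<zeta>))\<^sup>2 \<le> (1 - (cmod z)\<^sup>2) / (1 - cmod z)\<^sup>2"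
    using p by (intro divide_left_mono) auto
qed

lemma poisson_kernel_nonneg:
  "cmod z < 1 \<Longrightarrow> 0 \<le> (1 - (cmod z)\<^sup>2) / (cmod (z - \<zeta>))\<^sup>2"
  by (simp add: power_le_one)

context
  fixes \<mu> :: "complex measure" and z :: complex
  assumes \<mu>: "circle_measure \<mu>" and z: "cmod z < 1"
begin

interpretation finite_measure \<mu>
  using \<mu> by (simp add: circle_measure_def)

text \<open>A Bochner integral defaults to 0 when the integrand is not integrable, so this is what
  gives \<open>poisson\<close> its intended value and permits the passage to nonnegative
  integrals.\<close>

lemma poisson_kernel_integrable:
  "integrable \<mu> (\<lambda>\<zeta>. (1 - (cmod z)\<^sup>2) / (cmod (z - \<zeta>))\<^sup>2)"
proof (rule integrable_const_bound)
  have [measurable_cong]: "sets \<mu> = sets borel"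
    using \<mu> by (simp add: circle_measure_def)
  show "(\<lambda>\<zeta>. (1 - (cmod z)\<^sup>2) / (cmod (z - \<zeta>))\<^sup>2) \<in> borel_measurable \<mu>"
    by measurable
  show "AE \<zeta> in \<mu>. norm ((1 - (cmod z)\<^sup>2) / (cmod (z - \<zeta>))\<^sup>2) \<le> (1 - (cmod z)\<^sup>2) / (1 - cmod z)\<^sup>2"
    using circle_measure_AE[OF \<mu>]
    by eventually_elim (simp only: real_norm_def abs_of_nonneg[OF poisson_kernel_nonneg[OF z]] poisson_kernel_bounds(2)[OF z])
qed

text \<open>Since |z - \<zeta>| <= 2 on the circle, the kernel is at least (1 - |z|^2)/4. The growth
  estimate sees \<mu> through this bound, that is, through its total mass.\<close>

lemma poisson_lower: "(1 - (cmod z)\<^sup>2) / 4 * measure \<mu> UNIV \<le> poisson \<mu> z"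
proof -
  have "(\<integral>\<zeta>. (1 - (cmod z)\<^sup>2) / 4 \<partial>\<mu>) \<le> poisson \<mu> z"
    unfolding poisson_def
  proof (rule integral_mono_AE[OF _ poisson_kernel_integrable])
    show "AE \<zeta> in \<mu>. (1 - (cmod z)\<^sup>2) / 4 \<le> (1 - (cmod z)\<^sup>2) / (cmod (z - \<zeta>))\<^sup>2"
      using circle_measure_AE[OF \<mu>] by eventually_elim (rule poisson_kernel_bounds(1)[OF z])
  qed simp
  moreover have "space \<mu> = UNIV"
    using \<mu> sets_eq_imp_space_eq[of \<mu> borel] by (simp add: circle_measure_def)
  ultimately show ?thesis by (simp add: mult.commute)
qed

lemma poisson_nonneg: "0 \<le> poisson \<mu> z"
  unfolding poisson_def by (rule integral_nonneg_AE) (simp add: poisson_kernel_nonneg[OF z])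

lemma poisson_nn_integral:
  "ennreal (poisson \<mu> z) = (\<integral>\<^sup>+\<zeta>. ennreal ((1 - (cmod z)\<^sup>2) / (cmod (z - \<zeta>))\<^sup>2) \<partial>\<mu>)"
  unfolding poisson_def
  by (rule nn_integral_eq_integral[symmetric, OF poisson_kernel_integrable]) 
     (simp add: poisson_kernel_nonneg[OF z])

end

lemma circle_measure_pos:
  assumes "circle_measure \<mu>" "\<mu> \<noteq> null_measure borel"
  shows "0 < measure \<mu> UNIV"
proof (rule ccontr)
  assume "\<not> ?thesis"
  then have "measure \<mu> UNIV = 0" by (simp add: zero_less_measure_iff)
  moreover have fin: "finite_measure \<mu>" and s: "sets \<mu> = sets borel"
    using assms(1) by (auto simp: circle_measure_def)
  ultimately have 0: "emeasure \<mu> UNIV = 0"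
    by (simp add: finite_measure.emeasure_eq_measure)
  have "\<mu> = null_measure borel"
  proof (rule measure_eqI)
    fix A assume "A \<in> sets \<mu>"
    have "emeasure \<mu> A \<le> emeasure \<mu> UNIV" by (rule emeasure_mono) (auto simp: s)
    then show "emeasure \<mu> A = emeasure (null_measure borel) A" using 0 by simp
  qed (simp add: s)
  then show False using assms(2) by simp
qed

text \<open>Tonelli moves the area integral inside. For each \<zeta> on the circle the kernel has
  circular means 1, so its integral over the disc is the area of the disc, whence the total is this
  area times the mass of \<mu>.\<close>

lemma poisson_disc_integral:
  assumes \<mu>: "circle_measure \<mu>"
  shows "(\<lambda>z. ennreal (poisson \<mu> z) * indicator (ball 0 1) z) \<in> borel_measurable borel"
    and "(\<integral>\<^sup>+z. ennreal (poisson \<mu> z) * indicator (ball 0 1) z \<partial>lborel) < \<infinity>"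
proof -
  define k where "k z \<zeta> = (if cmod z < 1 then ennreal ((1 - (cmod z)\<^sup>2) / (cmod (z - \<zeta>))\<^sup>2) else 0)"
    for z \<zeta> :: complex
  have fin: "finite_measure \<mu>" and s [measurable_cong]: "sets \<mu> = sets borel"
    using \<mu> by (auto simp: circle_measure_def)
  interpret finite_measure \<mu> by (rule fin)
  interpret lborel_\<mu>: pair_sigma_finite "lborel :: complex measure" \<mu> ..
  have km: "(\<lambda>z. k z \<zeta>) \<in> borel_measurable borel" for \<zeta>
    unfolding k_def by measurable
  have "case_prod k \<in> borel_measurable (borel \<Otimes>\<^sub>M borel)"
    unfolding k_def by measurable
  then have kpm: "case_prod k \<in> borel_measurable (lborel \<Otimes>\<^sub>M \<mu>)"
    using measurable_cong_sets[OF sets_pair_measure_cong[OF sets_lborel s] refl] by blast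
  have pk: "ennreal (poisson \<mu> z) * indicator (ball 0 1) z = (\<integral>\<^sup>+\<zeta>. k z \<zeta> \<partial>\<mu>)" for z
    by (cases "z \<in> ball 0 1") (auto simp: k_def poisson_nn_integral[OF \<mu>])
  show "(\<lambda>z. ennreal (poisson \<mu> z) * indicator (ball 0 1) z) \<in> borel_measurable borel"
    using borel_measurable_nn_integral[OF kpm] unfolding pk by simp
  have "(\<integral>\<^sup>+z. ennreal (poisson \<mu> z) * indicator (ball 0 1) z \<partial>lborel)
      = (\<integral>\<^sup>+z. (\<integral>\<^sup>+\<zeta>. k z \<zeta> \<partial>\<mu>) \<partial>lborel)"
    by (simp only: pk)
  also have "\<dots> = (\<integral>\<^sup>+\<zeta>. (\<integral>\<^sup>+z. k z \<zeta> \<partial>lborel) \<partial>\<mu>)"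
    by (rule lborel_\<mu>.Fubini'[symmetric, OF kpm])
  also have "\<dots> = (\<integral>\<^sup>+\<zeta>. emeasure lborel (ball (0::complex) 1) \<partial>\<mu>)"
  proof (rule nn_integral_cong_AE)
    show "AE \<zeta> in \<mu>. (\<integral>\<^sup>+z. k z \<zeta> \<partial>lborel) = emeasure lborel (ball (0::complex) 1)"
      using circle_measure_AE[OF \<mu>]
    proof eventually_elim
      fix \<zeta> :: complex assume \<zeta>: "cmod \<zeta> = 1"
      have "ennreal (2*pi) * (\<integral>\<^sup>+z. k z \<zeta> \<partial>lborel)
         = (\<integral>\<^sup>+z. (\<integral>\<^sup>+t. k (cis t * z) \<zeta> * indicator {0..2*pi} t \<partial>lborel) \<partial>lborel)"
        by (rule rotation_average[OF km])
      also have "\<dots> = (\<integral>\<^sup>+z. ennreal (2 * pi) * indicator (ball 0 1) z \<partial>(lborel::complex measure))"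
      proof (intro nn_integral_cong)
        fix z :: complex
        show "(\<integral>\<^sup>+t. k (cis t * z) \<zeta> * indicator {0..2*pi} t \<partial>lborel)
            = ennreal (2 * pi) * indicator (ball 0 1) z"
          using poisson_circle_mean[OF _ \<zeta>, of z]
          by (cases "z \<in> ball 0 1") (simp_all add: k_def norm_mult)
      qed
      also have "\<dots> = ennreal (2 * pi) * emeasure lborel (ball (0::complex) 1)"
        by (rule nn_integral_cmult_indicator) simp
      finally show "(\<integral>\<^sup>+z. k z \<zeta> \<partial>lborel) = emeasure lborel (ball (0::complex) 1)"
        by (simp add: ennreal_mult_cancel_left)
    qed
  qed
  also have "\<dots> < \<infinity>"
    using emeasure_lborel_ball_finite[of "0::complex" 1]
    by (simp add: ennreal_mult_less_top emeasure_eq_measure)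
  finally show "(\<integral>\<^sup>+z. ennreal (poisson \<mu> z) * indicator (ball 0 1) z \<partial>lborel) < \<infinity>" .
qed

section \<open>Entire functions in the weighted spaces\<close>

text \<open>Serves the indices with zero measure, for which \<open>Hmuj\<close> is \<open>H2\<close>
  by definition.\<close>

lemma entire_in_H2:
  assumes f: "f holomorphic_on UNIV"
  shows "f \<in> H2"
proof -
  have "continuous_on (cball 0 1) f"
    using holomorphic_on_imp_continuous_on[OF f] continuous_on_subset by blast
  then have "bounded (f ` cball 0 1)"
    by (intro compact_imp_bounded compact_continuous_image) auto
  then obtain M where M: "\<And>z. cmod z \<le> 1 \<Longrightarrow> cmod (f z) \<le> M"
    unfolding bounded_iff by (metis dist_0_norm imageI mem_cball)
  have "integral {0..2*pi} (\<lambda>t. (cmod (f (complex_of_real r * cis t)))\<^sup>2) \<le> 2 * pi * M\<^sup>2"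
    if r: "r \<in> {0..<1}" for r
  proof -
    have "continuous_on {0..2*pi} (\<lambda>t. (cmod (f (complex_of_real r * cis t)))\<^sup>2)"
      by (intro continuous_intros continuous_on_compose2[OF holomorphic_on_imp_continuous_on[OF f]]) auto
    then have "integral {0..2*pi} (\<lambda>t. (cmod (f (complex_of_real r * cis t)))\<^sup>2)
       \<le> integral {0..2*pi} (\<lambda>t. M\<^sup>2)"
      using r by (intro integral_le integrable_continuous_interval power_mono M)
        (auto simp: norm_mult)
    then show ?thesis by simp
  qed
  then show ?thesis
    unfolding H2_def using f by (auto intro!: bdd_aboveI2[where M = "2 * pi * M\<^sup>2"] intro: holomorphic_on_subset)
qed

lemma Dint_finite_iff:
  "Dint \<mu> j f < \<infinity> \<longleftrightarrow>
    (\<integral>\<^sup>+ z. ennreal ((cmod ((deriv ^^ j) f z))\<^sup>2 * poisson \<mu> z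
        * (1 - (cmod z)\<^sup>2) ^ (j - 1)) * indicator (ball 0 1) z \<partial>lborel) < \<infinity>"
  unfolding Dint_def infinity_ennreal_def less_top[symmetric] by (simp add: ennreal_divide_eq_top_iff)

text \<open>For nonzero \<mu> the derivative is bounded on the closed disc and the powers of 1 -
  |z|^2 are at most 1, so finiteness reduces to the integrability of the Poisson integral over the
  disc.\<close>

lemma entire_in_Hmuj:
  assumes f: "f holomorphic_on UNIV" and \<mu>: "circle_measure \<mu>" and j: "1 \<le> j"
  shows "f \<in> Hmuj \<mu> j"
proof (cases "\<mu> = null_measure borel")
  case True
  then show ?thesis using entire_in_H2[OF f] by (simp add: Hmuj_def)
next
  case False
  have hol: "(deriv ^^ j) f holomorphic_on UNIV"
    using f by (rule holomorphic_higher_deriv) simp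
  have "bounded ((deriv ^^ j) f ` cball 0 1)"
    by (intro compact_imp_bounded compact_continuous_image
        holomorphic_on_imp_continuous_on[OF holomorphic_on_subset[OF hol]]) auto
  then obtain M where M: "\<And>z. cmod z \<le> 1 \<Longrightarrow> cmod ((deriv ^^ j) f z) \<le> M"
    unfolding bounded_iff by (metis dist_0_norm imageI mem_cball)
  have "(\<integral>\<^sup>+ z. ennreal ((cmod ((deriv ^^ j) f z))\<^sup>2 * poisson \<mu> z
        * (1 - (cmod z)\<^sup>2) ^ (j - 1)) * indicator (ball 0 1) z \<partial>lborel)
      \<le> (\<integral>\<^sup>+ z. ennreal (M\<^sup>2) * (ennreal (poisson \<mu> z) * indicator (ball 0 1) z) \<partial>lborel)"
  proof (intro nn_integral_mono)
    fix z :: complex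
    show "ennreal ((cmod ((deriv ^^ j) f z))\<^sup>2 * poisson \<mu> z
        * (1 - (cmod z)\<^sup>2) ^ (j - 1)) * indicator (ball 0 1) z
      \<le> ennreal (M\<^sup>2) * (ennreal (poisson \<mu> z) * indicator (ball 0 1) z)"
    proof (cases "z \<in> ball 0 1")
      case True
      then have z: "cmod z < 1" by simp
      have "(cmod ((deriv ^^ j) f z))\<^sup>2 * poisson \<mu> z * (1 - (cmod z)\<^sup>2) ^ (j - 1)
         \<le> M\<^sup>2 * poisson \<mu> z * 1"
        using M[of z] z poisson_nonneg[OF \<mu> z]
        by (intro mult_mono power_mono power_le_one) (auto simp: power_le_one)
      then show ?thesis using True poisson_nonneg[OF \<mu> z]
        by (simp add: ennreal_leI flip: ennreal_mult)
    qed simp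
  qed
  also have "\<dots> < \<infinity>"
    using poisson_disc_integral[OF \<mu>] by (simp add: nn_integral_cmult ennreal_mult_less_top)
  finally have "Dint \<mu> j f < \<infinity>"
    by (simp only: Dint_finite_iff)
  then show ?thesis using f False by (auto simp: Hmuj_def intro: holomorphic_on_subset)
qed

section \<open>Growth of functions in the weighted spaces\<close>

text \<open>Integrating the bound on the derivative along the radius to \<open>w\<close> gains one
  power of 1 - |w|. As \<open>s > 0\<close>, the antiderivative is again a power, and its factor is
  at least 1, which lets it absorb the constant |g(0)|.\<close>

lemma radial_integration_bound:
  assumes g: "g holomorphic_on ball 0 1" and s: "0 < s" and C: "0 \<le> C"
    and bound: "\<And>w. cmod w < 1 \<Longrightarrow> cmod (deriv g w) \<le> C * (1 - cmod w) powr (-(s + 1))"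
    and w: "cmod w < 1"
  shows "cmod (g w) \<le> (cmod (g 0) + C / s) * (1 - cmod w) powr (-s)"
proof (cases "w = 0")
  case True
  then show ?thesis using C s by simp
next
  case False
  define r where "r = cmod w"
  define u where "u = w / of_real r"
  have r: "0 < r" "r < 1" using False w by (auto simp: r_def)
  have u: "cmod u = 1" and wu: "w = of_real r * u" using r by (auto simp: u_def r_def norm_divide)
  have in1: "cmod (of_real t * u) < 1" if "t \<in> {0..r}" for t
    using that r u by (simp add: norm_mult)
  have "norm (g (of_real r * u) - g (of_real 0 * u))
      \<le> C / s * (1 - r) powr (-s) - C / s * (1 - 0) powr (-s)"
  proof (rule differentiable_bound_general[OF r(1),
        where f' = "\<lambda>t. u * deriv g (of_real t * u)" and \<phi>' = "\<lambda>t. C * (1 - t) powr (-(s+1))"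
        and \<phi> = "\<lambda>t. C / s * (1 - t) powr (-s)" and f = "\<lambda>t. g (of_real t * u)"])
    show "continuous_on {0..r} (\<lambda>t. g (of_real t * u))"
      by (rule continuous_on_compose2[OF holomorphic_on_imp_continuous_on[OF g]])
         (use in1 in \<open>auto intro!: continuous_intros\<close>)
    show "continuous_on {0..r} (\<lambda>t. C / s * (1 - t) powr (-s))"
      using r by (intro continuous_intros) auto
    fix t assume t: "0 < t" "t < r"
    have "(g has_field_derivative deriv g (of_real t * u)) (at (of_real t * u))"
      by (rule holomorphic_derivI[OF g]) (use in1[of t] t in auto)
    moreover have "((\<lambda>t. of_real t * u) has_vector_derivative u) (at t)"
      by (auto intro!: derivative_eq_intros)
    ultimately show "((\<lambda>t. g (of_real t * u)) has_vector_derivative u * deriv g (of_real t * u)) (at t)"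
      using field_vector_diff_chain_at[of "\<lambda>t. of_real t * u" u t g "deriv g (of_real t * u)"]
      by (simp add: o_def)
    have "((\<lambda>t. C / s * (1 - t) powr (-s)) has_real_derivative
        C / s * ((1 - t) powr (-s - 1) * (-s) * (-1))) (at t)"
      using t r s by (auto intro!: derivative_eq_intros simp: powr_diff field_simps)
    moreover have "C / s * ((1 - t) powr (-s - 1) * (-s) * (-1)) = C * (1 - t) powr (-(s+1))"
    proof -
      have "- s - 1 = -(s + 1)" by simp
      then show ?thesis using s by (simp only:) simp
    qed
    ultimately show "((\<lambda>t. C / s * (1 - t) powr (-s)) has_vector_derivative C * (1 - t) powr (-(s+1))) (at t)"
      by (simp add: has_real_derivative_iff_has_vector_derivative)
    show "norm (u * deriv g (of_real t * u)) \<le> C * (1 - t) powr (-(s+1))"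
      using bound[of "of_real t * u"] in1[of t] t u by (simp add: norm_mult)
  qed
  then have "cmod (g w - g 0) \<le> C / s * (1 - r) powr (-s) - C / s" by (simp add: wu)
  moreover have "cmod (g w) \<le> cmod (g 0) + cmod (g w - g 0)"
    by (metis add.commute diff_add_cancel norm_triangle_ineq)
  moreover have "1 \<le> (1 - r) powr (-s)"
    using powr_mono_both'[of "-s" 0 "1-r" "1-r"] r s ge_one_powr_ge_zero
    by (simp add: powr_minus_divide powr_le1)
  then have "cmod (g 0) \<le> cmod (g 0) * (1 - r) powr (-s)"
    by (simp add: mult_le_cancel_left1)
  moreover have "C / s \<ge> 0" using C s by simp
  ultimately show ?thesis unfolding r_def[symmetric] distrib_right by linarith
qed

text \<open>The exponents run from \<open>j + s\<close> down to \<open>s\<close> and stay positive,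
  so no logarithm appears at any stage.\<close>

lemma iterated_radial_integration:
  assumes "f holomorphic_on ball 0 1" "0 < s"
    and "\<exists>C\<ge>0. \<forall>w. cmod w < 1 \<longrightarrow> cmod ((deriv ^^ j) f w) \<le> C * (1 - cmod w) powr (-(real j + s))"
  shows "\<exists>C\<ge>0. \<forall>w. cmod w < 1 \<longrightarrow> cmod (f w) \<le> C * (1 - cmod w) powr (-s)"
  using assms(3)
proof (induction j)
  case 0
  then show ?case by simp
next
  case (Suc j)
  from Suc.prems obtain C where C: "C \<ge> 0" 
    "\<And>w. cmod w < 1 \<Longrightarrow> cmod (deriv ((deriv ^^ j) f) w) \<le> C * (1 - cmod w) powr (-((real j + s) + 1))"
    by (auto simp: add_ac)
  have "(deriv ^^ j) f holomorphic_on ball 0 1"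
    using assms(1) by (rule holomorphic_higher_deriv) simp
  from radial_integration_bound[OF this _ C] assms(2)
  show ?case
    by (intro Suc.IH exI[of _ "cmod ((deriv ^^ j) f 0) + C / (real j + s)"]) (use C(1) in auto)
qed

text \<open>On the disc of radius R = (1 - |w|)/2 about \<open>w\<close> the weight is at least a
  constant times R^j. The submean inequality for the j-th derivative then bounds its squared modulus
  at \<open>w\<close> by a constant times R^(-(j+2)), and j radial integrations follow.\<close>

lemma Hmuj_growth:
  assumes \<mu>: "circle_measure \<mu>" "\<mu> \<noteq> null_measure borel" and j: "2 \<le> j" and f: "f \<in> Hmuj \<mu> j"
  shows "\<exists>C\<ge>0. \<forall>w. cmod w < 1 \<longrightarrow> cmod (f w) \<le> C * (1 - cmod w) powr (-(1/4))"
proof (rule iterated_radial_integration[where j = j])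
  show fh: "f holomorphic_on ball 0 1" using f \<mu> by (simp add: Hmuj_def)
  define M where "M = measure \<mu> UNIV / 4"
  have M: "M > 0" using circle_measure_pos[OF \<mu>] by (simp add: M_def)
  define g where "g = (deriv ^^ j) f"
  have g: "g holomorphic_on ball 0 1"
    unfolding g_def using fh by (rule holomorphic_higher_deriv) simp
  define I where "I = (\<integral>\<^sup>+ z. ennreal ((cmod (g z))\<^sup>2 * poisson \<mu> z
        * (1 - (cmod z)\<^sup>2) ^ (j - 1)) * indicator (ball 0 1) z \<partial>lborel)"
  have "I < \<infinity>"
    using f \<mu> Dint_finite_iff[of \<mu> j f] by (simp add: Hmuj_def I_def g_def)
  then obtain J where J: "I = ennreal J" "0 \<le> J" by (cases I) auto
  have area: "pi * R\<^sup>2 * (cmod (g w))\<^sup>2 * (M * R ^ j) \<le> J"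
    if w: "cmod w < 1" and R: "R = (1 - cmod w) / 2" for w R
  proof -
    have R0: "0 < R" using w R by simp
    have sub: "ball w R \<subseteq> ball 0 1"
    proof
      fix z assume "z \<in> ball w R"
      then show "z \<in> ball 0 1" using R w norm_triangle_ineq2[of z w]
        by (simp add: dist_norm norm_minus_commute field_simps)
    qed
    have "ennreal (pi * R\<^sup>2 * (cmod (g w))\<^sup>2) \<le> (\<integral>\<^sup>+z. ennreal ((cmod (g z))\<^sup>2) * indicator (ball w R) z \<partial>lborel)"
      using g sub R0 by (intro submean_value) (auto intro: holomorphic_on_subset)
    then have "ennreal (pi * R\<^sup>2 * (cmod (g w))\<^sup>2) * ennreal (M * R ^ j)
      \<le> (\<integral>\<^sup>+z. ennreal ((cmod (g z))\<^sup>2) * indicator (ball w R) z \<partial>lborel) * ennreal (M * R ^ j)"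
      by (rule mult_right_mono) simp
    also have "\<dots> = (\<integral>\<^sup>+z. ennreal ((cmod (g z))\<^sup>2) * indicator (ball w R) z * ennreal (M * R ^ j) \<partial>lborel)"
      using cmod_square_indicator_measurable[OF continuous_on_subset[OF holomorphic_on_imp_continuous_on[OF g] sub]]
      by (intro nn_integral_multc[symmetric]) simp
    also have "\<dots> \<le> I"
      unfolding I_def
    proof (intro nn_integral_mono)
      fix z
      show "ennreal ((cmod (g z))\<^sup>2) * indicator (ball w R) z * ennreal (M * R ^ j)
         \<le> ennreal ((cmod (g z))\<^sup>2 * poisson \<mu> z * (1 - (cmod z)\<^sup>2) ^ (j - 1)) * indicator (ball 0 1) z"
      proof (cases "z \<in> ball w R")
        case True
        then have z: "cmod z < 1" using sub by auto
        \<comment> \<open>Since 1 - |w| = 2 R, a point within R of \<open>w\<close> keeps distance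
          at least R from the circle.\<close>
        have "R \<le> 1 - cmod z"
          using True R norm_triangle_ineq2[of z w] by (simp add: dist_norm norm_minus_commute field_simps)
        also have "\<dots> \<le> 1 - (cmod z)\<^sup>2"
          using z by (simp add: power2_eq_square mult_left_le)
        finally have Rz: "R \<le> 1 - (cmod z)\<^sup>2" .
        have "M * R ^ j \<le> M * (1 - (cmod z)\<^sup>2) ^ j"
          using M R0 Rz by (intro mult_left_mono power_mono) auto
        also have "\<dots> = (1 - (cmod z)\<^sup>2) / 4 * measure \<mu> UNIV * (1 - (cmod z)\<^sup>2) ^ (j - 1)"
          using j by (cases j) (auto simp: M_def)
        also have "\<dots> \<le> poisson \<mu> z * (1 - (cmod z)\<^sup>2) ^ (j - 1)"
          using Rz R0 by (intro mult_right_mono poisson_lower \<mu> z zero_le_power) auto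
        finally have "(cmod (g z))\<^sup>2 * (M * R ^ j) 
            \<le> (cmod (g z))\<^sup>2 * (poisson \<mu> z * (1 - (cmod z)\<^sup>2) ^ (j - 1))"
          by (rule mult_left_mono) simp
        then show ?thesis using True z M R0
          by (simp add: ennreal_leI mult.assoc flip: ennreal_mult)
      qed simp
    qed
    finally show ?thesis
      using J M R0 by (simp flip: ennreal_mult)
  qed
  define C where "C = sqrt (J / (pi * M)) * 2 powr (real j + 1/4)"
  have "cmod (g w) \<le> C * (1 - cmod w) powr (-(real j + 1/4))" if w: "cmod w < 1" for w
  proof -
    define R where "R = (1 - cmod w) / 2"
    have R: "0 < R" "R < 1" using w by (auto simp: R_def) (use norm_ge_zero[of w] in linarith)
    have "(cmod (g w))\<^sup>2 * R ^ (j + 2) \<le> J / (pi * M)"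
      using area[OF w R_def] M by (simp add: field_simps power_add power2_eq_square)
    \<comment> \<open>Here \<open>j \<ge> 2\<close> decides: j + 2 <= 2 j and R < 1, so the j-th
      derivative is O(R^(-j)), a rate that j integrations remove up to a logarithm.\<close>
    moreover have "R ^ (2 * j) \<le> R ^ (j + 2)"
      using j R by (intro power_decreasing) auto
    ultimately have "(cmod (g w))\<^sup>2 * R ^ (2 * j) \<le> J / (pi * M)"
      by (meson mult_left_mono order_trans zero_le_power2)
    then have "(cmod (g w) * R ^ j)\<^sup>2 \<le> J / (pi * M)"
      by (simp add: power_mult_distrib power_mult[symmetric] mult.commute)
    then have "cmod (g w) * R ^ j \<le> sqrt (J / (pi * M))"
      using real_le_rsqrt by blast
    then have "cmod (g w) \<le> sqrt (J / (pi * M)) * R powr (- real j)"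
      using R by (simp add: powr_minus powr_realpow field_simps)
    \<comment> \<open>The exponent is weakened by 1/4 on purpose, to reach the form
      \<open>j + s\<close> with \<open>s > 0\<close> that the iterated integration expects.\<close>
    also have "\<dots> \<le> sqrt (J / (pi * M)) * R powr (-(real j + 1/4))"
      using R J M by (intro mult_left_mono powr_mono') auto
    also have "\<dots> = C * (1 - cmod w) powr (-(real j + 1/4))"
      using w by (simp add: C_def R_def powr_divide powr_minus field_simps)
    finally show ?thesis .
  qed
  moreover have "C \<ge> 0" using J M by (simp add: C_def)
  ultimately show "\<exists>C\<ge>0. \<forall>w. cmod w < 1 \<longrightarrow>
      cmod ((deriv ^^ j) f w) \<le> C * (1 - cmod w) powr (-(real j + 1/4))"
    unfolding g_def by blast
qed simp

section \<open>Schwarz--Pick estimates for the kernel\<close>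

lemma one_minus_cnj_nonzero:
  fixes z w :: complex
  assumes "cmod z < 1" "cmod w \<le> 1"
  shows "1 - z * cnj w \<noteq> 0"
proof -
  have "cmod (z * cnj w) < 1"
    using mult_mono[of "cmod z" "cmod z" "cmod w" 1] assms by (simp add: norm_mult)
  then show ?thesis by auto
qed

text \<open>Divided by |1 - z conj(w)|^2 this is the formula for 1 - |\<phi>(z)|^2, where \<phi> is
  the disc automorphism sending \<open>w\<close> to 0. It underlies all comparisons of
  pseudohyperbolic distances below.\<close>

lemma moebius_modulus_identity:
  fixes z w :: complex
  shows "(cmod (1 - z * cnj w))\<^sup>2 - (cmod (z - w))\<^sup>2 = (1 - (cmod z)\<^sup>2) * (1 - (cmod w)\<^sup>2)"
  unfolding cmod_power2 by (simp add: algebra_simps power2_eq_square)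

text \<open>Compose \<open>b\<close> with disc automorphisms that move \<open>w\<close> and
  \<open>b w\<close> to 0 and apply the Schwarz lemma. The conclusion is cleared of denominators, so
  that it survives a limit in which |b| reaches 1.\<close>

lemma Schwarz_Pick_strict:
  assumes b: "b holomorphic_on ball 0 1" and b1: "\<And>z. cmod z < 1 \<Longrightarrow> cmod (b z) < 1"
    and z: "cmod z < 1" and w: "cmod w < 1"
  shows "cmod (b z - b w) * cmod (1 - z * cnj w) \<le> cmod (z - w) * cmod (1 - b z * cnj (b w))"
proof -
  define f where "f u = (b ((u + w) / (1 + cnj w * u)) - b w) / (1 - cnj (b w) * b ((u + w) / (1 + cnj w * u)))" for u
  have nz: "1 + cnj w * u \<noteq> 0" if "cmod u < 1" for u
    using one_minus_cnj_nonzero[of "-u" w] that w by (simp add: mult.commute)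
  have in1: "cmod ((u + w) / (1 + cnj w * u)) < 1" if u: "cmod u < 1" for u
  proof -
    have "0 < (1 - (cmod u)\<^sup>2) * (1 - (cmod w)\<^sup>2)"
      using u w by (intro mult_pos_pos) (auto simp: power_less_one_iff abs_square_less_1)
    then have "(cmod (u + w))\<^sup>2 < (cmod (1 + cnj w * u))\<^sup>2"
      using moebius_modulus_identity[of "-u" w]
      by (simp add: norm_minus_commute mult.commute add.commute)
    then have "cmod (u + w) < cmod (1 + cnj w * u)" by (rule power_less_imp_less_base) simp
    then show ?thesis using nz[OF u] by (simp add: norm_divide)
  qed
  have h1: "(\<lambda>u. b ((u + w) / (1 + cnj w * u))) holomorphic_on ball 0 1"
  proof (rule holomorphic_on_compose_gen[of _ "ball 0 1" b "ball 0 1", unfolded o_def, OF _ b])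
    show "(\<lambda>u. (u + w) / (1 + cnj w * u)) holomorphic_on ball 0 1"
      using nz by (intro holomorphic_intros) auto
    show "(\<lambda>u. (u + w) / (1 + cnj w * u)) ` ball 0 1 \<subseteq> ball 0 1"
      using in1 by (auto simp: image_subset_iff simp del: norm_divide)
  qed
  have nz2: "1 - cnj (b w) * c \<noteq> 0" if "cmod c < 1" for c
    using one_minus_cnj_nonzero[OF that, of "b w"] b1[OF w] by (simp add: mult.commute)
  have fh: "f holomorphic_on ball 0 1"
    unfolding f_def using nz2 b1 in1 by (intro holomorphic_intros h1) (simp_all del: norm_divide)
  have f1: "cmod (f u) < 1" if u: "cmod u < 1" for u
  proof -
    define c where "c = b ((u + w) / (1 + cnj w * u))"
    have c: "cmod c < 1" unfolding c_def by (rule b1[OF in1[OF u]])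
    have "0 < (1 - (cmod c)\<^sup>2) * (1 - (cmod (b w))\<^sup>2)"
      using c b1[OF w] by (intro mult_pos_pos) (auto simp: abs_square_less_1)
    then have "(cmod (c - b w))\<^sup>2 < (cmod (1 - cnj (b w) * c))\<^sup>2"
      using moebius_modulus_identity[of c "b w"] by (simp add: mult.commute)
    then have "cmod (c - b w) < cmod (1 - cnj (b w) * c)" by (rule power_less_imp_less_base) simp
    then show ?thesis using nz2[OF c] by (simp add: f_def c_def norm_divide)
  qed
  have f0: "f 0 = 0" by (simp add: f_def)
  define u where "u = (z - w) / (1 - cnj w * z)"
  have nzz: "1 - cnj w * z \<noteq> 0" using one_minus_cnj_nonzero[OF z, of w] w by (simp add: mult.commute)
  have u1: "cmod u < 1"
  proof -
    have "0 < (1 - (cmod z)\<^sup>2) * (1 - (cmod w)\<^sup>2)"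
      using z w by (intro mult_pos_pos) (auto simp: abs_square_less_1)
    then have "(cmod (z - w))\<^sup>2 < (cmod (1 - cnj w * z))\<^sup>2"
      using moebius_modulus_identity[of z w] by (simp add: mult.commute)
    then have "cmod (z - w) < cmod (1 - cnj w * z)" by (rule power_less_imp_less_base) simp
    then show ?thesis using nzz by (simp add: u_def norm_divide)
  qed
  have zu: "(u + w) / (1 + cnj w * u) = z"
  proof -
    have "((u + w) - z * (1 + cnj w * u)) * (1 - cnj w * z)
        = u * (1 - cnj w * z) * (1 - cnj w * z) + (w - z) * (1 - cnj w * z)"
      by (simp add: algebra_simps)
    also have "u * (1 - cnj w * z) = z - w" using nzz by (simp add: u_def)
    finally have "((u + w) - z * (1 + cnj w * u)) * (1 - cnj w * z) = 0"
      by (simp add: algebra_simps)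
    then have "u + w = z * (1 + cnj w * u)" using nzz by simp
    then show ?thesis using nz[OF u1] by simp
  qed
  have "cmod (f u) \<le> cmod u"
    using Schwarz_Lemma(1)[OF fh f0 f1 u1] by simp
  then have "cmod (b z - b w) / cmod (1 - cnj (b w) * b z) \<le> cmod (z - w) / cmod (1 - cnj w * z)"
    unfolding f_def zu by (simp add: u_def norm_divide)
  then show ?thesis
    using nzz nz2[OF b1[OF z]] by (simp add: field_simps)
qed

text \<open>The strict version is applied to r b with r < 1 and r tends to 1, which admits points
  with |b| = 1. Squaring and using the modulus identity on both sides turns it into a statement
  about the kernel.\<close>

lemma Schwarz_Pick:
  assumes b: "b holomorphic_on ball 0 1" and b1: "\<And>z. cmod z < 1 \<Longrightarrow> cmod (b z) \<le> 1"
    and z: "cmod z < 1" and w: "cmod w < 1"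
  shows "(cmod (1 - b z * cnj (b w)))\<^sup>2 * ((1 - (cmod z)\<^sup>2) * (1 - (cmod w)\<^sup>2))
     \<le> (1 - (cmod (b z))\<^sup>2) * (1 - (cmod (b w))\<^sup>2) * (cmod (1 - z * cnj w))\<^sup>2"
proof -
  define F where "F r = cmod (of_real r * b z - of_real r * b w) * cmod (1 - z * cnj w)" for r :: real
  define G where "G r = cmod (z - w) * cmod (1 - of_real r * b z * cnj (of_real r * b w))" for r :: real
  have "F 1 \<le> G 1"
  proof (rule tendsto_le)
    show "at_left (1::real) \<noteq> bot" by simp
    have "continuous_on UNIV F" "continuous_on UNIV G"
      unfolding F_def G_def by (intro continuous_intros)+
    then show "(F \<longlongrightarrow> F 1) (at_left 1)" "(G \<longlongrightarrow> G 1) (at_left 1)"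
      by (meson UNIV_I continuous_on_def tendsto_within_subset subset_UNIV)+
    have "eventually (\<lambda>r::real. r \<in> {0<..<1}) (at_left 1)"
      by (rule eventually_at_left_real) simp
    then show "eventually (\<lambda>r. F r \<le> G r) (at_left 1)"
    proof eventually_elim
      fix r :: real assume r: "r \<in> {0<..<1}"
      have "cmod (of_real r * b z) < 1" if "cmod z < 1" for z
      proof -
        have "r * cmod (b z) \<le> r * 1" using b1[OF that] r by (intro mult_left_mono) auto
        also have "\<dots> < 1" using r by simp
        finally show ?thesis using r by (simp add: norm_mult)
      qed
      then show "F r \<le> G r"
        unfolding F_def G_def using b
        by (intro Schwarz_Pick_strict[of "\<lambda>z. of_real r * b z"] z w) (auto intro: holomorphic_intros)
    qed
  qed
  then have "cmod (b z - b w) * cmod (1 - z * cnj w) \<le> cmod (z - w) * cmod (1 - b z * cnj (b w))"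
    by (simp add: F_def G_def)
  then have "(cmod (b z - b w) * cmod (1 - z * cnj w))\<^sup>2 \<le> (cmod (z - w) * cmod (1 - b z * cnj (b w)))\<^sup>2"
    by (intro power_mono) auto
  then show ?thesis
    unfolding moebius_modulus_identity[symmetric]
    by (simp add: power_mult_distrib algebra_simps)
qed

lemma dBR_kernel_diag:
  "dBR_kernel b w w = of_real ((1 - (cmod (b w))\<^sup>2) / (1 - (cmod w)\<^sup>2))"
  unfolding dBR_kernel_def complex_norm_square[symmetric] by simp

text \<open>The Cauchy-Schwarz inequality for kernel functions: N(z) =
  \<open>sqrt (Re (dBR_kernel b z z))\<close> is the norm of the kernel function at z. It is the
  Schwarz-Pick inequality divided by the Szegoe denominators.\<close>

lemma dBR_kernel_bound:
  assumes b: "b holomorphic_on ball 0 1" and b1: "\<And>z. cmod z < 1 \<Longrightarrow> cmod (b z) \<le> 1"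
    and z: "cmod z < 1" and w: "cmod w < 1"
  shows "cmod (dBR_kernel b z w) \<le> sqrt (Re (dBR_kernel b z z)) * sqrt (Re (dBR_kernel b w w))"
proof -
  have p: "0 < 1 - (cmod z)\<^sup>2" "0 < 1 - (cmod w)\<^sup>2"
    using z w by (auto simp: abs_square_less_1)
  have q: "0 < (cmod (1 - z * cnj w))\<^sup>2" using one_minus_cnj_nonzero[OF z, of w] w by simp
  have "(cmod (dBR_kernel b z w))\<^sup>2 \<le> Re (dBR_kernel b z z) * Re (dBR_kernel b w w)"
  proof -
    have frac: "x / q \<le> A / (r * s)" if "x * (r * s) \<le> A * q" "0 < r" "0 < s" "0 < q"
      for x A q r s :: real
      using that by (simp add: field_simps)
    show ?thesis
      using frac[OF Schwarz_Pick[OF b b1 z w] p q]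
      by (simp add: dBR_kernel_diag del: of_real_divide) 
         (simp add: dBR_kernel_def norm_divide power_divide)
  qed
  then show ?thesis
    unfolding real_sqrt_mult[symmetric] by (rule real_le_rsqrt)
qed

section \<open>Boundary behaviour of the symbol\<close>

lemma cmod_diff_partial_sums:
  fixes \<phi> :: "nat \<Rightarrow> complex"
  shows "cmod (sum \<phi> {..<n} - sum \<phi> {..<k}) \<le> (\<Sum>l=min n k..<max n k. cmod (\<phi> l))"
proof -
  have *: "cmod (sum \<phi> {..<n} - sum \<phi> {..<k}) \<le> (\<Sum>l=k..<n. cmod (\<phi> l))" if "k \<le> n" for n k
  proof -
    have "sum \<phi> {..<n} - sum \<phi> {..<k} = sum \<phi> {k..<n}"
      using sum_diff_nat_ivl[of 0 k n \<phi>] that by (simp add: lessThan_atLeast0)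
    then show ?thesis by (simp add: norm_sum)
  qed
  show ?thesis
    using *[of k n] *[of n k] by (cases "k \<le> n") (auto simp: norm_minus_commute min_def max_def)
qed

section \<open>Series of kernel functions and the gliding hump\<close>

text \<open>Reading N(w) as a bound for the norm of the kernel function at w, the hypothesis is
  absolute convergence in norm. In coordinates, the Gram double sum of a difference of partial sums
  is at most the square of the corresponding segment of the scalar series.\<close>

lemma rkhs_series:
  fixes K :: "complex \<Rightarrow> complex \<Rightarrow> complex" and N :: "complex \<Rightarrow> real"
  assumes bound: "\<And>z v. z \<in> S \<Longrightarrow> v \<in> S \<Longrightarrow> cmod (K z v) \<le> N z * N v"
    and N: "\<And>z. 0 \<le> N z" and w: "\<And>l. w l \<in> S"
    and sm: "summable (\<lambda>l. cmod (c l) * N (w l))"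
  shows "(\<lambda>z. \<Sum>l. c l * K z (w l)) \<in> rkhs K S"
proof -
  define g where "g n = map (\<lambda>l. (c l, w l)) [0..<n]" for n :: nat
  \<comment> \<open>\<open>kdiff\<close> concatenates without cancelling, so terms common to both
    lists occur twice, with opposite coefficients. A summand that is odd in the coefficient makes
    them cancel; this is used for the inner and for the outer sum.\<close>
  have kdiff_sum: "(\<Sum>(c, w)\<leftarrow>kdiff (g n) (g k). h c w) = (\<Sum>l<n. h (c l) (w l)) - (\<Sum>l<k. h (c l) (w l))"
    if "\<And>c w. h (- c) w = - h c w" for h :: "complex \<Rightarrow> complex \<Rightarrow> complex" and n k
    by (simp add: kdiff_def g_def o_def that interv_sum_list_conv_sum_set_nat sum_negf lessThan_atLeast0)
  define seg where "seg n k = (\<Sum>l=min n k..<max n k. cmod (c l) * N (w l))" for n k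
  have normsq: "knormsq K (kdiff (g n) (g k)) \<le> (seg n k)\<^sup>2" for n k
  proof -
    define X where "X = kdiff (g n) (g k)"
    define q where "q a u = (\<Sum>(d, v)\<leftarrow>X. a * cnj d * K v u)" for a u
    have q: "q a u = (\<Sum>l<n. a * cnj (c l) * K (w l) u) - (\<Sum>l<k. a * cnj (c l) * K (w l) u)" for a u
      unfolding q_def X_def by (rule kdiff_sum) simp
    have qb: "cmod (q a u) \<le> cmod a * N u * seg n k" if "u \<in> S" for a u
    proof -
      have "cmod (q a u) \<le> (\<Sum>l=min n k..<max n k. cmod (a * cnj (c l) * K (w l) u))"
        unfolding q by (rule cmod_diff_partial_sums)
      also have "\<dots> \<le> (\<Sum>l=min n k..<max n k. cmod a * N u * (cmod (c l) * N (w l)))"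
      proof (rule sum_mono)
        fix l
        have "cmod (a * cnj (c l)) * cmod (K (w l) u) \<le> cmod (a * cnj (c l)) * (N (w l) * N u)"
          using bound[OF w that] by (intro mult_left_mono) auto
        then show "cmod (a * cnj (c l) * K (w l) u) \<le> cmod a * N u * (cmod (c l) * N (w l))"
          by (simp add: norm_mult mult_ac)
      qed
      finally show ?thesis by (simp add: seg_def sum_distrib_left)
    qed
    have "(\<Sum>(a, u)\<leftarrow>X. q a u) = (\<Sum>l<n. q (c l) (w l)) - (\<Sum>l<k. q (c l) (w l))"
      unfolding X_def by (rule kdiff_sum) (simp add: q sum_negf)
    then have "cmod (\<Sum>(a, u)\<leftarrow>X. q a u) \<le> (\<Sum>l=min n k..<max n k. cmod (q (c l) (w l)))"
      by (simp add: cmod_diff_partial_sums)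
    also have "\<dots> \<le> (\<Sum>l=min n k..<max n k. cmod (c l) * N (w l) * seg n k)"
      by (intro sum_mono qb w)
    also have "\<dots> = (seg n k)\<^sup>2"
      by (simp add: seg_def power2_eq_square sum_distrib_right)
    finally have "cmod (\<Sum>(a, u)\<leftarrow>X. q a u) \<le> (seg n k)\<^sup>2" .
    moreover have "knormsq K X = Re (\<Sum>(a, u)\<leftarrow>X. q a u)"
      by (simp add: knormsq_def q_def)
    ultimately show ?thesis
      unfolding X_def using complex_Re_le_cmod order_trans by metis
  qed
  have "\<exists>M. \<forall>n\<ge>M. \<forall>k\<ge>M. knormsq K (kdiff (g n) (g k)) < e" if e: "e > 0" for e
  proof -
    obtain M where M: "\<And>m n. m \<ge> M \<Longrightarrow> norm (\<Sum>l=m..<n. cmod (c l) * N (w l)) < sqrt e"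
      using sm e unfolding summable_Cauchy by (meson real_sqrt_gt_0_iff)
    have "knormsq K (kdiff (g n) (g k)) < e" if "n \<ge> M" "k \<ge> M" for n k
    proof -
      have "norm (seg n k) < sqrt e" unfolding seg_def by (rule M) (use that in auto)
      then have "\<bar>seg n k\<bar>\<^sup>2 < (sqrt e)\<^sup>2" by (intro power_strict_mono) auto
      then show ?thesis using normsq[of n k] e by simp
    qed
    then show ?thesis by blast
  qed
  moreover have "(\<lambda>n. keval K (g n) z) \<longlonglongrightarrow> (\<Sum>l. c l * K z (w l))" if z: "z \<in> S" for z
  proof -
    have "summable (\<lambda>l. c l * K z (w l))"
    proof (rule summable_comparison_test')
      show "summable (\<lambda>l. N z * (cmod (c l) * N (w l)))" by (rule summable_mult[OF sm])
      show "norm (c l * K z (w l)) \<le> N z * (cmod (c l) * N (w l))" for l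
        using mult_left_mono[OF bound[OF z w], of "cmod (c l)" l] by (simp add: norm_mult mult_ac)
    qed
    then have "(\<lambda>n. \<Sum>l<n. c l * K z (w l)) \<longlonglongrightarrow> (\<Sum>l. c l * K z (w l))" by (rule summable_LIMSEQ)
    then show ?thesis
      by (simp add: keval_def g_def o_def interv_sum_list_conv_sum_set_nat lessThan_atLeast0)
  qed
  moreover have "\<forall>n. \<forall>(c, w)\<in>set (g n). w \<in> S" using w by (auto simp: g_def)
  ultimately show ?thesis unfolding rkhs_def by blast
qed

text \<open>One of \<open>|x + y|\<close>, \<open>|x - y|\<close> is at least \<open>|y|\<close>, which fixes the signs one at a time;
  the ratio \<open>1/4\<close> keeps the later terms too small to undo the choice.\<close>
lemma gliding_signs:
  fixes X :: "nat \<Rightarrow> nat \<Rightarrow> complex"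
  assumes X1: "\<And>i l. cmod (X i l) \<le> 1" and Xd: "\<And>i. cmod (X i i) = 1"
  obtains s :: "nat \<Rightarrow> complex" where "\<And>l. cmod (s l) = 1"
    "\<And>i. 2 / 3 * (1 / 4) ^ i \<le> cmod (\<Sum>l. s l * (1 / 4) ^ l * X i l)"
proof -
  define \<sigma> :: "nat \<Rightarrow> (nat \<Rightarrow> complex) \<Rightarrow> complex" where
    "\<sigma> n q = (if cmod (q n - (1 / 4) ^ n * X n n) \<le> cmod (q n + (1 / 4) ^ n * X n n) then 1 else - 1)" for n q
  \<comment> \<open>The recursion carries the partial sums of all rows at once: sign
    \<open>n\<close> is chosen by looking at row \<open>n\<close>, but it enters every row.\<close>
  define p where "p = rec_nat (\<lambda>i. 0) (\<lambda>n q i. q i + \<sigma> n q * (1 / 4) ^ n * X i n)"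
  define s where "s n = \<sigma> n (p n)" for n
  have p_sum: "p n i = (\<Sum>l<n. s l * (1 / 4) ^ l * X i l)" for n i
    by (induction n) (simp_all add: p_def s_def)
  have s1: "cmod (s l) = 1" for l by (simp add: s_def \<sigma>_def)
  have max: "cmod y \<le> cmod (x + y) \<or> cmod y \<le> cmod (x - y)" for x y :: complex
  proof -
    have "2 * cmod y = cmod ((x + y) - (x - y))" by (simp add: norm_mult flip: mult_2)
    also have "\<dots> \<le> cmod (x + y) + cmod (x - y)" by (rule norm_triangle_ineq4)
    finally show ?thesis by linarith
  qed
  have ps: "(1 / 4) ^ i \<le> cmod (p (Suc i) i)" for i
  proof -
    have "cmod ((1 / 4) ^ i * X i i) = (1 / 4) ^ i" by (simp add: norm_mult norm_power norm_divide Xd)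
    moreover have "p (Suc i) i = p i i + s i * (1 / 4) ^ i * X i i" by (simp add: p_sum)
    ultimately show ?thesis
      using max[of "(1 / 4) ^ i * X i i" "p i i"] by (auto simp: s_def \<sigma>_def)
  qed
  have "2 / 3 * (1 / 4) ^ i \<le> cmod (\<Sum>l. s l * (1 / 4) ^ l * X i l)" for i
  proof -
    have summand: "norm (s l * (1 / 4) ^ l * X i l) \<le> (1 / 4) ^ l" for l
      using X1[of i l] mult_left_le[of "cmod (X i l)" "(1/4)^l"]
      by (simp add: norm_mult norm_power norm_divide s1)
    have geo: "summable (\<lambda>l. (1 / 4 :: real) ^ l)" by (rule summable_geometric) simp
    have sm: "summable (\<lambda>l. s l * (1 / 4) ^ l * X i l)"
      by (rule summable_comparison_test'[OF geo summand])
    have tail: "norm (\<Sum>l. s (l + Suc i) * (1 / 4) ^ (l + Suc i) * X i (l + Suc i))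
        \<le> (\<Sum>l. (1 / 4) ^ (l + Suc i))"
      by (rule norm_suminf_le) (use summand geo summable_ignore_initial_segment in blast)+
    \<comment> \<open>The terms after position \<open>i\<close> add up to one third of the term at
      \<open>i\<close>; this is the origin of the factor 2/3 = 1 - 1/3.\<close>
    have "(\<Sum>l. (1 / 4 :: real) ^ (l + Suc i)) = (1 / 4) ^ Suc i * (\<Sum>l. (1 / 4) ^ l)"
      unfolding power_add by (subst suminf_mult[OF geo, symmetric]) (simp add: mult.commute)
    also have "\<dots> = 1 / 3 * (1 / 4) ^ i" by (simp add: suminf_geometric)
    finally have geo_sum: "(\<Sum>l. (1 / 4 :: real) ^ (l + Suc i)) = 1 / 3 * (1 / 4) ^ i" .
    have "(\<Sum>l. s l * (1 / 4) ^ l * X i l)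
        = (\<Sum>l. s (l + Suc i) * (1 / 4) ^ (l + Suc i) * X i (l + Suc i)) + p (Suc i) i"
      unfolding p_sum by (rule suminf_split_initial_segment[OF sm])
    moreover have "cmod y \<le> cmod x + norm t" if "x = t + y" for x y t :: complex
      using norm_triangle_ineq4[of x t] that by simp
    ultimately have "cmod (p (Suc i) i) \<le> cmod (\<Sum>l. s l * (1 / 4) ^ l * X i l)
        + norm (\<Sum>l. s (l + Suc i) * (1 / 4) ^ (l + Suc i) * X i (l + Suc i))"
      by blast
    with tail ps[of i] show ?thesis unfolding geo_sum by linarith
  qed
  with s1 that show ?thesis by blast
qed

text \<open>If |b| stays below 1 - e along points \<open>w i\<close> tending to the circle, the
  kernel norms there grow like the power -1/2 of 1 - |w|. A signed series of normalised kernels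
  keeps this size at each \<open>w i\<close>, up to the factor 4^(-i), against an allowed power of
  -1/4.\<close>

lemma boundary_modulus_one:
  assumes b: "b holomorphic_on ball 0 1" and b1: "\<And>z. cmod z < 1 \<Longrightarrow> cmod (b z) \<le> 1"
    and growth: "\<And>f. f \<in> dBR b \<Longrightarrow> \<exists>C\<ge>0. \<forall>w. cmod w < 1 \<longrightarrow> cmod (f w) \<le> C * (1 - cmod w) powr (-(1/4))"
    and e: "0 < e"
  shows "\<exists>r<1. \<forall>w. r \<le> cmod w \<longrightarrow> cmod w < 1 \<longrightarrow> 1 - e < cmod (b w)"
proof (rule ccontr)
  assume "\<not> ?thesis"
  then have ex: "\<And>r. r < 1 \<Longrightarrow> \<exists>w. r \<le> cmod w \<and> cmod w < 1 \<and> cmod (b w) \<le> 1 - e"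
    by (meson not_less)
  \<comment> \<open>The exponent \<open>8 * i\<close> makes the power -1/4 of the distance to the
    circle at least 4^(2i), which outweighs the loss 4^(-i) by a factor 4^i.\<close>
  have "\<exists>w. 1 - (1 / 4) ^ (8 * i) \<le> cmod w \<and> cmod w < 1 \<and> cmod (b w) \<le> 1 - e" for i :: nat
    by (rule ex) simp
  then obtain w where w: "\<And>i. 1 - (1 / 4) ^ (8 * i) \<le> cmod (w i)" "\<And>i. cmod (w i) < 1"
      "\<And>i. cmod (b (w i)) \<le> 1 - e"
    by metis
  define N where "N z = sqrt (Re (dBR_kernel b z z))" for z
  define \<delta> where "\<delta> i = 1 - cmod (w i)" for i
  have \<delta>: "0 < \<delta> i" "\<delta> i \<le> (1 / 4) ^ (8 * i)" for i using w(1,2)[of i] by (auto simp: \<delta>_def)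
  \<comment> \<open>The power -1/2 is written as a product of two powers -1/4, so that one factor
    cancels against the growth bound.\<close>
  have N_lower: "sqrt (e / 2) * (\<delta> i powr (-(1/4)) * \<delta> i powr (-(1/4))) \<le> N (w i)" for i
  proof -
    have "e \<le> 1 - (cmod (b (w i)))\<^sup>2"
    proof -
      have "(cmod (b (w i)))\<^sup>2 \<le> cmod (b (w i)) * 1"
        unfolding power2_eq_square using b1[OF w(2)] by (intro mult_left_mono) auto
      then show ?thesis using w(3)[of i] by simp
    qed
    moreover have "1 - (cmod (w i))\<^sup>2 \<le> 2 * \<delta> i"
      using zero_le_power2[of "1 - cmod (w i)"] by (simp add: \<delta>_def power2_diff)
    moreover have "0 < 1 - (cmod (w i))\<^sup>2" using w(2)[of i] by (simp add: abs_square_less_1)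
    ultimately have "e / (2 * \<delta> i) \<le> (1 - (cmod (b (w i)))\<^sup>2) / (1 - (cmod (w i))\<^sup>2)"
      using e by (intro frac_le) auto
    then have "sqrt (e / (2 * \<delta> i)) \<le> N (w i)"
      by (simp add: N_def dBR_kernel_diag del: of_real_divide)
    moreover have "sqrt (e / (2 * \<delta> i)) = sqrt (e / 2) * (\<delta> i powr (-(1/4)) * \<delta> i powr (-(1/4)))"
    proof -
      have "\<delta> i powr (-(1/4)) * \<delta> i powr (-(1/4)) = \<delta> i powr (-(1/2))"
        by (subst powr_add[symmetric]) simp
      also have "\<dots> = inverse (sqrt (\<delta> i))"
        using \<delta>(1)[of i] by (subst powr_minus) (simp add: powr_half_sqrt)
      finally have "\<delta> i powr (-(1/4)) * \<delta> i powr (-(1/4)) = sqrt (inverse (\<delta> i))"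
        by (simp only: real_sqrt_inverse)
      then have "sqrt (e / 2) * (\<delta> i powr (-(1/4)) * \<delta> i powr (-(1/4))) = sqrt (e / 2 * inverse (\<delta> i))"
        by (simp only: real_sqrt_mult)
      also have "e / 2 * inverse (\<delta> i) = e / (2 * \<delta> i)"
        using \<delta>(1)[of i] by (simp only: divide_inverse inverse_mult_distrib mult.assoc)
      finally show ?thesis by (rule sym)
    qed
    ultimately show ?thesis by (simp only:)
  qed
  have Npos: "0 < N (w i)" for i
  proof -
    have "0 < sqrt (e / 2) * (\<delta> i powr (-(1/4)) * \<delta> i powr (-(1/4)))"
      using e \<delta>(1)[of i] by (intro mult_pos_pos) auto
    with N_lower[of i] show ?thesis by linarith
  qed
  have N0: "0 \<le> N z" if "cmod z < 1" for z
    using b1[OF that] that by (simp add: N_def dBR_kernel_diag power_le_one del: of_real_divide)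
  have bound: "cmod (dBR_kernel b z v) \<le> N z * N v" if "z \<in> ball 0 1" "v \<in> ball 0 1" for z v
    unfolding N_def using that by (intro dBR_kernel_bound b b1) auto
  \<comment> \<open>The Gram matrix of the normalised kernel functions: entries of modulus at most
    1, diagonal 1, as the choice of signs demands.\<close>
  define X where "X i l = dBR_kernel b (w i) (w l) / of_real (N (w i) * N (w l))" for i l
  have X1: "cmod (X i l) \<le> 1" for i l
    using bound[of "w i" "w l"] w(2) Npos[of i] Npos[of l] by (simp add: X_def norm_divide norm_mult)
  have Xd: "cmod (X i i) = 1" for i
  proof -
    have "0 < sqrt (Re (dBR_kernel b (w i) (w i)))" using Npos[of i] by (simp add: N_def)
    then have "N (w i) * N (w i) = Re (dBR_kernel b (w i) (w i))" by (simp add: N_def)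
    moreover have "dBR_kernel b (w i) (w i) = of_real (Re (dBR_kernel b (w i) (w i)))"
      unfolding dBR_kernel_diag by simp
    ultimately have "dBR_kernel b (w i) (w i) = of_real (N (w i) * N (w i))" by simp
    then show ?thesis using Npos[of i] by (simp add: X_def)
  qed
  obtain s where s: "\<And>l. cmod (s l) = 1"
    "\<And>i. 2 / 3 * (1 / 4) ^ i \<le> cmod (\<Sum>l. s l * (1 / 4) ^ l * X i l)"
    using gliding_signs[of X, OF X1 Xd] by blast
  define c where "c l = s l * (1 / 4) ^ l / of_real (N (w l))" for l
  define f where "f z = (\<Sum>l. c l * dBR_kernel b z (w l))" for z
  have "f \<in> dBR b"
    unfolding dBR_def f_def
  \<comment> \<open>The absolute value is taken because the bound function has to be nonnegative
    everywhere, while \<open>N\<close> is known to be so only on the disc.\<close>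
  proof (rule rkhs_series[where N = "\<lambda>z. \<bar>N z\<bar>"])
    have "cmod (c l) * \<bar>N (w l)\<bar> = (1 / 4) ^ l" for l
      using Npos[of l] by (simp add: c_def norm_mult norm_divide norm_power s(1))
    then show "summable (\<lambda>l. cmod (c l) * \<bar>N (w l)\<bar>)" by (simp add: summable_geometric)
    show "cmod (dBR_kernel b z v) \<le> \<bar>N z\<bar> * \<bar>N v\<bar>" if "z \<in> ball 0 1" "v \<in> ball 0 1" for z v
      using bound[OF that] N0[of z] N0[of v] that by simp
  qed (use w in auto)
  from growth[OF this] obtain C where C: "C \<ge> 0" "\<And>w. cmod w < 1 \<Longrightarrow> cmod (f w) \<le> C * (1 - cmod w) powr (-(1/4))"
    by blast
  have "2 / 3 * sqrt (e / 2) * 4 ^ i \<le> C" for i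
  proof -
    define d where "d = \<delta> i powr (-(1/4))"
    have d: "0 < d" using \<delta>(1)[of i] by (simp add: d_def)
    have "c l * dBR_kernel b (w i) (w l) = of_real (N (w i)) * (s l * (1 / 4) ^ l * X i l)" for l
      using Npos[of i] Npos[of l] by (simp add: c_def X_def)
    moreover have "summable (\<lambda>l. s l * (1 / 4) ^ l * X i l)"
    proof (rule summable_comparison_test')
      show "summable (\<lambda>l. (1 / 4 :: real) ^ l)" by (rule summable_geometric) simp
      show "norm (s l * (1 / 4) ^ l * X i l) \<le> (1 / 4) ^ l" for l
        using X1[of i l] mult_left_le[of "cmod (X i l)" "(1/4)^l"]
        by (simp add: norm_mult norm_power norm_divide s)
    qed
    ultimately have fw: "f (w i) = of_real (N (w i)) * (\<Sum>l. s l * (1 / 4) ^ l * X i l)"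
      by (simp add: f_def suminf_mult)
    have "sqrt (e / 2) * (d * d) * (2 / 3 * (1 / 4) ^ i) \<le> N (w i) * (2 / 3 * (1 / 4) ^ i)"
      using N_lower[of i] unfolding d_def by (rule mult_right_mono) simp
    also have "N (w i) * (2 / 3 * (1 / 4) ^ i) \<le> cmod (f (w i))"
      using fw s(2)[of i] Npos[of i] by (simp add: norm_mult)
    also have "\<dots> \<le> C * d" using C(2)[OF w(2)] by (simp add: d_def \<delta>_def)
    finally have "(sqrt (e / 2) * (2 / 3) * (1 / 4) ^ i * d) * d \<le> C * d" by (simp add: mult_ac)
    then have le: "sqrt (e / 2) * (2 / 3) * (1 / 4) ^ i * d \<le> C" using d by (simp only: mult_le_cancel_right_pos)
    have "((1 / 4) ^ (8 * i)) powr (-(1/4)) \<le> d"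
      unfolding d_def using \<delta>[of i] by (intro powr_mono2') auto
    moreover have "((1 / 4 :: real) ^ (8 * i)) powr (-(1/4)) = 4 ^ (2 * i)"
    proof -
      have "((1 / 4 :: real) ^ (8 * i)) powr (-(1/4)) = ((1/4) powr (8 * i)) powr (-(1/4))"
        by (simp add: powr_realpow[symmetric])
      also have "\<dots> = (1/4) powr (- real (2 * i))" unfolding powr_powr by simp
      also have "\<dots> = 4 ^ (2 * i)" unfolding powr_minus by (subst powr_realpow) (auto simp: power_one_over)
      finally show ?thesis .
    qed
    ultimately have "sqrt (e / 2) * (2 / 3) * (1 / 4) ^ i * 4 ^ (2 * i) \<le> sqrt (e / 2) * (2 / 3) * (1 / 4) ^ i * d"
      using e by (intro mult_left_mono) auto
    moreover have "(1 / 4 :: real) ^ i * 4 ^ (2 * i) = (1 / 4 * 4\<^sup>2) ^ i"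
      by (simp only: power_mult power_mult_distrib)
    ultimately show ?thesis using le by (simp add: mult.assoc)
  qed
  moreover obtain i where "C / (2 / 3 * sqrt (e / 2)) < 4 ^ i"
    using real_arch_pow[of 4] by auto
  then have "C < 2 / 3 * sqrt (e / 2) * 4 ^ i"
    using e by (simp add: field_simps)
  ultimately show False using not_less by blast
qed

section \<open>Finite Blaschke products\<close>

text \<open>If |b(z)| < 1, then on a circle close to the boundary |b| exceeds |b(z)|, so 1/b is
  smaller there than at the interior point z, against the maximum modulus principle.\<close>

lemma nonvanishing_unimodular:
  assumes b: "b holomorphic_on ball 0 1" and b1: "\<And>z. cmod z < 1 \<Longrightarrow> cmod (b z) \<le> 1"
    and bdry: "\<And>e. 0 < e \<Longrightarrow> \<exists>r<1. \<forall>w. r \<le> cmod w \<longrightarrow> cmod w < 1 \<longrightarrow> 1 - e < cmod (b w)"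
    and nz: "\<And>z. cmod z < 1 \<Longrightarrow> b z \<noteq> 0" and z: "cmod z < 1"
  shows "cmod (b z) = 1"
proof (rule ccontr)
  assume "cmod (b z) \<noteq> 1"
  with b1[OF z] have lt: "cmod (b z) < 1" by simp
  obtain r where r: "r < 1" "\<And>w. r \<le> cmod w \<Longrightarrow> cmod w < 1 \<Longrightarrow> cmod (b z) < cmod (b w)"
    using bdry[of "1 - cmod (b z)"] lt by auto
  define R where "R = (1 + max r (cmod z)) / 2"
  have R: "r \<le> R" "cmod z \<le> R" "R < 1" using r(1) z by (auto simp: R_def)
  have "0 \<le> R" using R(2) norm_ge_zero[of z] by linarith
  have inv: "(\<lambda>z. inverse (b z)) holomorphic_on ball 0 1"
    using b nz by (intro holomorphic_intros) auto
  have sub: "cball 0 R \<subseteq> ball (0::complex) 1" using R by auto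
  have fr: "frontier (cball 0 R) \<subseteq> sphere (0::complex) R"
    by (simp add: frontier_cball)
  have comp: "compact (sphere (0::complex) R)" by simp
  have ne: "sphere (0::complex) R \<noteq> {}" using \<open>0 \<le> R\<close> by simp
  have cont: "continuous_on (sphere 0 R) (\<lambda>u. cmod (b u))"
    by (intro continuous_intros continuous_on_subset[OF holomorphic_on_imp_continuous_on[OF b]])
       (use R in auto)
  obtain m where m: "m \<in> sphere 0 R" "\<And>u. u \<in> sphere 0 R \<Longrightarrow> cmod (b m) \<le> cmod (b u)"
    using continuous_attains_inf[OF comp ne cont] by blast
  have bm: "cmod (b z) < cmod (b m)" using r(2)[of m] m(1) R by simp
  have m0: "0 < cmod (b m)" using nz[of m] m(1) R by simp
  have "cmod (inverse (b z)) \<le> inverse (cmod (b m))"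
  proof (rule maximum_modulus_frontier[of "\<lambda>z. inverse (b z)" "cball 0 R"])
    show "(\<lambda>z. inverse (b z)) holomorphic_on interior (cball 0 R)"
      using inv sub interior_subset by (blast intro: holomorphic_on_subset)
    show "continuous_on (closure (cball 0 R)) (\<lambda>z. inverse (b z))"
      using holomorphic_on_imp_continuous_on[OF inv] sub by (auto intro: continuous_on_subset)
    show "cmod (inverse (b u)) \<le> inverse (cmod (b m))" if "u \<in> frontier (cball 0 R)" for u
      using m fr that m0 by (auto simp: norm_inverse intro!: le_imp_inverse_le)
  qed (use R in auto)
  then have "cmod (b m) \<le> cmod (b z)"
    using m0 nz[OF z] by (simp add: norm_inverse)
  with bm show False by simp
qed

text \<open>Away from \<open>a\<close> the bound on \<open>h\<close> is Schwarz-Pick with second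
  point \<open>a\<close>, where \<open>b\<close> vanishes: |b(z)| is at most the modulus of the
  Blaschke factor. At \<open>a\<close> it follows by continuity.\<close>

lemma divide_by_Blaschke_factor:
  assumes b: "b holomorphic_on ball 0 1" and b1: "\<And>z. cmod z < 1 \<Longrightarrow> cmod (b z) \<le> 1"
    and a: "cmod a < 1" "b a = 0"
  obtains h where "h holomorphic_on ball 0 1"
    "\<And>z. cmod z < 1 \<Longrightarrow> b z = (z - a) / (1 - z * cnj a) * h z"
    "\<And>z. cmod z < 1 \<Longrightarrow> cmod (h z) \<le> 1"
proof -
  \<comment> \<open>The difference quotient with its removable singularity filled in.\<close>
  define q where "q z = (if z = a then deriv b a else (b z - b a) / (z - a))" for z
  have q: "q holomorphic_on ball 0 1"
    unfolding q_def using pole_lemma_open[OF b, of a] by simp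
  define h where "h z = (1 - z * cnj a) * q z" for z
  have h: "h holomorphic_on ball 0 1" unfolding h_def by (intro holomorphic_intros q)
  have eq: "b z = (z - a) / (1 - z * cnj a) * h z" if "cmod z < 1" for z
    using one_minus_cnj_nonzero[OF that, of a] a by (simp add: h_def q_def)
  have h1: "cmod (h z) \<le> 1" if z: "cmod z < 1" "z \<noteq> a" for z
  proof -
    have nz: "1 - z * cnj a \<noteq> 0" using one_minus_cnj_nonzero[OF z(1), of a] a by simp
    have "(1 - (cmod z)\<^sup>2) * (1 - (cmod a)\<^sup>2) \<le> (1 - (cmod (b z))\<^sup>2) * (cmod (1 - z * cnj a))\<^sup>2"
      using Schwarz_Pick[OF b b1 z(1) a(1)] a(2) by simp
    then have "(cmod (b z))\<^sup>2 * (cmod (1 - z * cnj a))\<^sup>2 \<le> (cmod (z - a))\<^sup>2"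
      unfolding moebius_modulus_identity[symmetric] by (simp add: algebra_simps)
    then have "(cmod (b z) * cmod (1 - z * cnj a))\<^sup>2 \<le> (cmod (z - a))\<^sup>2"
      by (simp add: power_mult_distrib)
    then have "cmod (b z) * cmod (1 - z * cnj a) \<le> cmod (z - a)"
      by (rule power2_le_imp_le) simp
    also have "cmod (b z) * cmod (1 - z * cnj a) = cmod (z - a) * cmod (h z)"
      using eq[OF z(1)] nz by (simp add: norm_mult norm_divide)
    finally show ?thesis using z(2) by (simp add: mult_le_cancel_left1)
  qed
  have "cmod (h a) \<le> 1"
  proof (rule tendsto_upperbound)
    have "isCont h a"
      using holomorphic_on_imp_continuous_on[OF h] a by (simp add: continuous_on_eq_continuous_at)
    then show "((\<lambda>z. cmod (h z)) \<longlongrightarrow> cmod (h a)) (at a)"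
      unfolding isCont_def by (rule tendsto_norm)
    have "eventually (\<lambda>z. z \<in> ball 0 1 - {a}) (at a)"
      using a by (intro eventually_at_in_open) auto
    then show "eventually (\<lambda>z. cmod (h z) \<le> 1) (at a)"
      by eventually_elim (use h1 in auto)
  qed simp
  with h1 have "\<And>z. cmod z < 1 \<Longrightarrow> cmod (h z) \<le> 1" by blast
  with h eq that show ?thesis by blast
qed

text \<open>With x, y the factor at z, w, split 1 - b(z) conj(b(w)) into (1 - x conj y) and x conj y
  (1 - h(z) conj(h(w))). The first part over 1 - z conj w is a product of a function of z and a
  function of w, so each zero raises the rank by at most one.\<close>

lemma dBR_kernel_Blaschke_factor:
  assumes z: "cmod z < 1" and w: "cmod w < 1" and a: "cmod a < 1"
    and bz: "b z = (z - a) / (1 - z * cnj a) * h z" and bw: "b w = (w - a) / (1 - w * cnj a) * h w"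
  shows "dBR_kernel b z w = (1 - a * cnj a) / ((1 - z * cnj a) * (1 - a * cnj w))
     + (z - a) / (1 - z * cnj a) * cnj ((w - a) / (1 - w * cnj a)) * dBR_kernel h z w"
proof -
  have nz: "1 - z * cnj a \<noteq> 0" "1 - a * cnj w \<noteq> 0" "1 - z * cnj w \<noteq> 0"
    using one_minus_cnj_nonzero[OF z, of a] one_minus_cnj_nonzero[OF a, of w] one_minus_cnj_nonzero[OF z, of w]
      a w by auto
  define x where "x = (z - a) / (1 - z * cnj a)"
  define y where "y = (w - a) / (1 - w * cnj a)"
  define p where "p = x * cnj y"
  have pe: "p = ((z - a) * (cnj w - cnj a)) / ((1 - z * cnj a) * (1 - a * cnj w))"
    by (simp add: p_def x_def y_def mult.commute)
  have "(1 - z * cnj a) * (1 - a * cnj w) - (z - a) * (cnj w - cnj a) = (1 - a * cnj a) * (1 - z * cnj w)"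
    by (simp add: algebra_simps)
  then have "1 - p = ((1 - a * cnj a) * (1 - z * cnj w)) / ((1 - z * cnj a) * (1 - a * cnj w))"
    using nz unfolding pe by (simp add: divide_simps)
  then have p1: "(1 - p) / (1 - z * cnj w) = (1 - a * cnj a) / ((1 - z * cnj a) * (1 - a * cnj w))"
    using nz by simp
  have "1 - b z * cnj (b w) = (1 - p) + p * (1 - h z * cnj (h w))"
    unfolding bz bw x_def[symmetric] y_def[symmetric] p_def by (simp add: algebra_simps)
  then show ?thesis
    unfolding x_def[symmetric] y_def[symmetric] p_def[symmetric] p1[symmetric] dBR_kernel_def by (simp only: add_divide_distrib times_divide_eq_right)
qed

text \<open>Dividing out Blaschke factors terminates because each of them has modulus at most
  \<open>\<rho> < 1\<close> at the fixed base point \<open>u\<close>.\<close>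
lemma dBR_kernel_finite_rank:
  assumes b: "b holomorphic_on ball 0 1" and b1: "\<And>z. cmod z < 1 \<Longrightarrow> cmod (b z) \<le> 1"
    and bdry: "\<And>e. 0 < e \<Longrightarrow> \<exists>r<1. \<forall>w. r \<le> cmod w \<longrightarrow> cmod w < 1 \<longrightarrow> 1 - e < cmod (b w)"
    and zeros: "\<And>a. cmod a < 1 \<Longrightarrow> b a = 0 \<Longrightarrow> cmod ((u - a) / (1 - u * cnj a)) \<le> \<rho>"
    and u: "cmod u < 1" and \<rho>: "0 < \<rho>" and large: "\<rho> ^ N < cmod (b u)"
  shows "\<exists>(n::nat) e d. \<forall>z w. cmod z < 1 \<longrightarrow> cmod w < 1 \<longrightarrow> dBR_kernel b z w = (\<Sum>i<n. e i z * d i w)"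
  using b b1 bdry zeros large
proof (induction N arbitrary: b)
  case 0
  \<comment> \<open>The hypothesis \<open>large\<close> reads 1 < |b u|, which is
    impossible.\<close>
  then show ?case using u by (metis not_less power_0)
next
  case (Suc N)
  note b = Suc.prems(1) and b1 = Suc.prems(2) and bdry = Suc.prems(3) and zeros = Suc.prems(4)
    and large = Suc.prems(5)
  show ?case
  proof (cases "\<exists>a. cmod a < 1 \<and> b a = 0")
    case False
    \<comment> \<open>Without zeros |b| = 1 throughout, and Schwarz-Pick forces the numerator of the
      kernel to vanish: rank 0.\<close>
    have "dBR_kernel b z w = 0" if "cmod z < 1" "cmod w < 1" for z w
    proof -
      have "cmod (b z) = 1"
        by (rule nonvanishing_unimodular[OF b b1 bdry]) (use False that in auto)
      then have "(cmod (1 - b z * cnj (b w)))\<^sup>2 * ((1 - (cmod z)\<^sup>2) * (1 - (cmod w)\<^sup>2)) \<le> 0"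
        using Schwarz_Pick[OF b b1 that] by simp
      moreover have "0 < (1 - (cmod z)\<^sup>2) * (1 - (cmod w)\<^sup>2)"
        using that by (intro mult_pos_pos) (auto simp: abs_square_less_1)
      ultimately have "1 - b z * cnj (b w) = 0"
        by (metis mult_pos_pos norm_eq_zero not_less zero_less_power2)
      then show ?thesis by (simp add: dBR_kernel_def)
    qed
    note zero = this
    show ?thesis
      by (intro exI[of _ "0::nat"] exI[of _ "\<lambda>_ _. 0"]) (simp add: zero)
  next
    case True
    then obtain a where a: "cmod a < 1" "b a = 0" by blast
    obtain h where h: "h holomorphic_on ball 0 1"
      "\<And>z. cmod z < 1 \<Longrightarrow> b z = (z - a) / (1 - z * cnj a) * h z"
      "\<And>z. cmod z < 1 \<Longrightarrow> cmod (h z) \<le> 1"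
      using divide_by_Blaschke_factor[OF b b1 a] by blast
    \<comment> \<open>Because of this, \<open>h\<close> inherits the boundary hypothesis. Its zeros
      are zeros of \<open>b\<close>, so the bound \<rho> persists, and a multiple zero is divided
      out once per multiplicity.\<close>
    have bh: "cmod (b z) \<le> cmod (h z)" if z: "cmod z < 1" for z
    proof -
      have "0 < (1 - (cmod z)\<^sup>2) * (1 - (cmod a)\<^sup>2)"
        using z a by (intro mult_pos_pos) (auto simp: abs_square_less_1)
      then have "(cmod (z - a))\<^sup>2 \<le> (cmod (1 - z * cnj a))\<^sup>2"
        using moebius_modulus_identity[of z a] by linarith
      then have "cmod (z - a) \<le> cmod (1 - z * cnj a)" by (rule power2_le_imp_le) simp
      then have "cmod ((z - a) / (1 - z * cnj a)) \<le> 1"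
        by (simp add: norm_divide divide_le_eq_1)
      then show ?thesis
        unfolding h(2)[OF z] norm_mult[of _ "h z"] by (simp add: mult_left_le_one_le)
    qed
    have "\<rho> * \<rho> ^ N < \<rho> * cmod (h u)"
    proof -
      have "\<rho> * \<rho> ^ N < cmod ((u - a) / (1 - u * cnj a)) * cmod (h u)"
        using large unfolding h(2)[OF u] norm_mult[of _ "h u"] by simp
      also have "\<dots> \<le> \<rho> * cmod (h u)" by (intro mult_right_mono zeros a) simp
      finally show ?thesis .
    qed
    then have large': "\<rho> ^ N < cmod (h u)" using \<rho> by simp
    have "\<exists>(n::nat) e d. \<forall>z w. cmod z < 1 \<longrightarrow> cmod w < 1 \<longrightarrow> dBR_kernel h z w = (\<Sum>i<n. e i z * d i w)"
    proof (rule Suc.IH[OF h(1) h(3) _ _ large'])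
      show "\<exists>r<1. \<forall>w. r \<le> cmod w \<longrightarrow> cmod w < 1 \<longrightarrow> 1 - e < cmod (h w)" if "0 < e" for e
        using bdry[OF that] bh by (meson less_le_trans)
      show "cmod ((u - c) / (1 - u * cnj c)) \<le> \<rho>" if "cmod c < 1" "h c = 0" for c
        using zeros[OF that(1)] h(2)[OF that(1)] that(2) by simp
    qed
    then obtain n :: nat and e d where ed: "\<And>z w. cmod z < 1 \<Longrightarrow> cmod w < 1 \<Longrightarrow> dBR_kernel h z w = (\<Sum>i<n. e i z * d i w)"
      by metis
    \<comment> \<open>The old terms pick up the Blaschke factor; slot \<open>n\<close> holds the new
      rank-one term.\<close>
    define e' where "e' i z = (if i = n then (1 - a * cnj a) / (1 - z * cnj a)
      else (z - a) / (1 - z * cnj a) * e i z)" for i :: nat and z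
    define d' where "d' i w = (if i = n then 1 / (1 - a * cnj w)
      else cnj ((w - a) / (1 - w * cnj a)) * d i w)" for i :: nat and w
    have "dBR_kernel b z w = (\<Sum>i<Suc n. e' i z * d' i w)" if "cmod z < 1" "cmod w < 1" for z w
    proof -
      have "(\<Sum>i<n. e' i z * d' i w)
        = (z - a) / (1 - z * cnj a) * cnj ((w - a) / (1 - w * cnj a)) * (\<Sum>i<n. e i z * d i w)"
        unfolding sum_distrib_left by (rule sum.cong) (auto simp: e'_def d'_def)
      then show ?thesis
        using dBR_kernel_Blaschke_factor[OF that a(1) h(2)[OF that(1)] h(2)[OF that(2)]]
        by (simp add: ed[OF that] e'_def d'_def)
    qed
    then show ?thesis by blast
  qed
qed

section \<open>Finite rank against interpolation\<close>

text \<open>Gaussian elimination: an unknown \<open>p\<close> with nonzero coefficient in equation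
  \<open>n\<close> is eliminated from the others, and its value is recovered from that
  equation.\<close>

lemma underdetermined_system:
  fixes v :: "'a \<Rightarrow> nat \<Rightarrow> 'b::field"
  assumes "finite A" "n < card A"
  shows "\<exists>c. (\<exists>i\<in>A. c i \<noteq> 0) \<and> (\<forall>j<n. (\<Sum>i\<in>A. c i * v i j) = 0)"
  using assms
proof (induction n arbitrary: A v)
  case 0
  then have "A \<noteq> {}" by auto
  then show ?case by (intro exI[of _ "\<lambda>_. 1"]) auto
next
  case (Suc n)
  show ?case
  proof (cases "\<exists>p\<in>A. v p n \<noteq> 0")
    case False
    then have zero: "(\<Sum>i\<in>A. c i * v i n) = 0" for c by (intro sum.neutral) auto
    obtain c where "\<exists>i\<in>A. c i \<noteq> 0" "\<forall>j<n. (\<Sum>i\<in>A. c i * v i j) = 0"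
      using Suc.IH[of A v] Suc.prems by auto
    then show ?thesis using zero by (intro exI[of _ c]) (auto simp: less_Suc_eq)
  next
    case True
    then obtain p where p: "p \<in> A" "v p n \<noteq> 0" by blast
    define u where "u i j = v i j - v i n / v p n * v p j" for i j
    have "n < card (A - {p})" using Suc.prems p by simp
    then obtain c where c: "\<exists>i\<in>A-{p}. c i \<noteq> 0" "\<forall>j<n. (\<Sum>i\<in>A-{p}. c i * u i j) = 0"
      using Suc.IH[of "A - {p}" u] Suc.prems(1) by auto
    define c' where "c' i = (if i = p then - (\<Sum>i\<in>A-{p}. c i * v i n) / v p n else c i)" for i
    have sum': "(\<Sum>i\<in>A. c' i * v i j) = (\<Sum>i\<in>A-{p}. c i * u i j)" for j
    proof -
      have "(\<Sum>i\<in>A. c' i * v i j) = c' p * v p j + (\<Sum>i\<in>A-{p}. c' i * v i j)"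
        by (rule sum.remove[OF Suc.prems(1) p(1)])
      also have "(\<Sum>i\<in>A-{p}. c' i * v i j) = (\<Sum>i\<in>A-{p}. c i * v i j)"
        by (rule sum.cong) (auto simp: c'_def)
      finally show ?thesis
        by (simp add: c'_def u_def algebra_simps sum_subtractf sum_distrib_left sum_divide_distrib sum_distrib_right)
    qed
    have "u i n = 0" for i using p by (simp add: u_def)
    then have "\<forall>j<Suc n. (\<Sum>i\<in>A. c' i * v i j) = 0"
      using c(2) by (auto simp: sum' less_Suc_eq)
    moreover have "\<exists>i\<in>A. c' i \<noteq> 0" using c(1) by (auto simp: c'_def)
    ultimately show ?thesis by blast
  qed
qed

text \<open>At n + 1 points some nontrivial combination of evaluations kills every
  \<open>e i\<close>, hence every finite combination of kernels, hence every pointwise limit of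
  these. Polynomials can take arbitrary values at these points, so some polynomial is not
  killed.\<close>

lemma rkhs_finite_rank_no_interpolation:
  fixes n :: nat
  assumes K: "\<And>z w. z \<in> S \<Longrightarrow> w \<in> S \<Longrightarrow> K z w = (\<Sum>i<n. e i z * d i w)"
    and S: "infinite S"
  shows "\<exists>f. f holomorphic_on UNIV \<and> f \<notin> rkhs K S"
proof -
  obtain A where A: "finite A" "card A = Suc n" "A \<subseteq> S"
    using infinite_arbitrarily_large[OF S] by blast
  obtain c where c: "\<exists>i\<in>A. c i \<noteq> 0" "\<forall>j<n. (\<Sum>z\<in>A. c z * e j z) = 0"
    using underdetermined_system[OF A(1), of n "\<lambda>z j. e j z"] A(2) by auto
  have kill: "(\<Sum>z\<in>A. c z * keval K xs z) = 0" if "\<forall>(a, w)\<in>set xs. w \<in> S" for xs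
    using that
  proof (induction xs)
    case Nil
    then show ?case by (simp add: keval_def)
  next
    case (Cons x xs)
    obtain a w where x: "x = (a, w)" by (cases x)
    have w: "w \<in> S" using Cons.prems x by simp
    have "(\<Sum>z\<in>A. c z * K z w) = (\<Sum>z\<in>A. \<Sum>i<n. d i w * (c z * e i z))"
      using K[OF _ w] A(3) by (intro sum.cong) (auto simp: sum_distrib_left mult_ac)
    also have "\<dots> = (\<Sum>i<n. d i w * (\<Sum>z\<in>A. c z * e i z))"
      by (subst sum.swap) (simp add: sum_distrib_left)
    finally have "(\<Sum>z\<in>A. c z * K z w) = 0" using c(2) by simp
    then have "(\<Sum>z\<in>A. c z * (a * K z w)) = 0"
      by (simp add: mult.left_commute[of _ a] flip: sum_distrib_left)
    then show ?case
      using Cons.IH Cons.prems by (simp add: x keval_def distrib_left sum.distrib)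
  qed
  have annihilate: "(\<Sum>z\<in>A. c z * f z) = 0" if f: "f \<in> rkhs K S" for f
  proof -
    obtain g where g: "\<forall>n. \<forall>(a, w)\<in>set (g n). w \<in> S" "\<forall>z\<in>S. (\<lambda>n. keval K (g n) z) \<longlonglongrightarrow> f z"
      using f unfolding rkhs_def by blast
    have "(\<lambda>n. \<Sum>z\<in>A. c z * keval K (g n) z) \<longlonglongrightarrow> (\<Sum>z\<in>A. c z * f z)"
      using g(2) A(3) by (intro tendsto_intros) auto
    then have "(\<lambda>n::nat. 0) \<longlonglongrightarrow> (\<Sum>z\<in>A. c z * f z)"
      using kill g(1) by simp
    then show ?thesis using LIMSEQ_unique tendsto_const by blast
  qed
  obtain p where p: "p \<in> A" "c p \<noteq> 0" using c(1) by blast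
  \<comment> \<open>The polynomial vanishing at all chosen points but \<open>p\<close>; the
    functional sends it to \<open>c p * f p\<close>, which is nonzero.\<close>
  define f where "f z = (\<Prod>q\<in>A-{p}. z - q)" for z
  have "f z = 0" if "z \<in> A - {p}" for z
    unfolding f_def using that A(1) by (intro prod_zero) auto
  then have "(\<Sum>z\<in>A. c z * f z) = c p * f p"
    using A(1) p(1) by (subst sum.remove[OF A(1) p(1)]) simp
  moreover have "f p \<noteq> 0" using A(1) by (simp add: f_def)
  ultimately have "f \<notin> rkhs K S" using annihilate p(2) by force
  moreover have "f holomorphic_on UNIV" unfolding f_def by (intro holomorphic_intros)
  ultimately show ?thesis by blast
qed

text \<open>Near the circle \<open>b\<close> has no zeros, so all of them lie in a smaller disc and
  are uniformly bounded away from 1 in pseudohyperbolic distance to the base point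
  \<open>z0\<close>. As b(z0) is nonzero, powers of this bound eventually drop below |b(z0)|, which
  limits how often one can divide.\<close>

lemma dBR_misses_entire_function:
  assumes b: "b holomorphic_on ball 0 1" and b1: "\<And>z. cmod z < 1 \<Longrightarrow> cmod (b z) \<le> 1"
    and bdry: "\<And>e. 0 < e \<Longrightarrow> \<exists>r<1. \<forall>w. r \<le> cmod w \<longrightarrow> cmod w < 1 \<longrightarrow> 1 - e < cmod (b w)"
  shows "\<exists>f. f holomorphic_on UNIV \<and> f \<notin> dBR b"
proof -
  obtain r where r: "r < 1" "\<And>w. r \<le> cmod w \<Longrightarrow> cmod w < 1 \<Longrightarrow> 0 < cmod (b w)"
    using bdry[of 1] by auto
  \<comment> \<open>\<open>r\<close> is known only to be less than 1 and may be negative, whereas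
    the base point needs a modulus.\<close>
  define r1 where "r1 = max r 0"
  have r1: "0 \<le> r1" "r1 < 1" using r(1) by (auto simp: r1_def)
  define z0 :: complex where "z0 = of_real r1"
  have z0: "cmod z0 < 1" "r \<le> cmod z0" using r1 by (auto simp: z0_def r1_def)
  \<comment> \<open>By the modulus identity 1 - |\<phi>|^2 = (1 - r1^2)(1 - |a|^2)/|1 - z0 conj a|^2
    for the factor at \<open>z0\<close>; zeros satisfy |a| <= r1 and the denominator is at most
    4.\<close>
  define \<rho> where "\<rho> = sqrt (1 - (1 - r1\<^sup>2) * (1 - r1\<^sup>2) / 4)"
  have q: "0 < 1 - r1\<^sup>2" "1 - r1\<^sup>2 \<le> 1" using r1 by (auto simp: abs_square_less_1)
  have qq: "0 < (1 - r1\<^sup>2) * (1 - r1\<^sup>2) / 4" "(1 - r1\<^sup>2) * (1 - r1\<^sup>2) / 4 < 1"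
    using q mult_le_one[of "1 - r1\<^sup>2" "1 - r1\<^sup>2"] by auto
  have \<rho>: "0 < \<rho>" "\<rho> < 1" using qq by (auto simp: \<rho>_def)
  obtain N where N: "\<rho> ^ N < cmod (b z0)"
    using real_arch_pow_inv[of "cmod (b z0)" \<rho>] \<rho> r(2)[OF z0(2,1)] by blast
  have zeros: "cmod ((z0 - a) / (1 - z0 * cnj a)) \<le> \<rho>" if a: "cmod a < 1" "b a = 0" for a
  proof -
    have "cmod a < r" using r(2)[of a] a by force
    then have ar: "(cmod a)\<^sup>2 \<le> r1\<^sup>2" by (intro power_mono) (auto simp: r1_def)
    have z0r: "(cmod z0)\<^sup>2 = r1\<^sup>2" using r1 by (simp add: z0_def)
    have nz: "1 - z0 * cnj a \<noteq> 0" using one_minus_cnj_nonzero[OF z0(1), of a] a by simp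
    define D where "D = (cmod (1 - z0 * cnj a))\<^sup>2"
    have D0: "0 < D" using nz by (simp add: D_def)
    have "cmod (1 - z0 * cnj a) \<le> 1 + cmod z0 * cmod a"
      using norm_triangle_ineq4[of 1 "z0 * cnj a"] by (simp add: norm_mult)
    also have "\<dots> \<le> 2" using z0 a mult_le_one[of "cmod z0" "cmod a"] by simp
    finally have D4: "D \<le> 4" unfolding D_def using power_mono[of "cmod (1 - z0 * cnj a)" 2 2] by simp
    have "(cmod (z0 - a))\<^sup>2 = D - (1 - r1\<^sup>2) * (1 - (cmod a)\<^sup>2)"
      using moebius_modulus_identity[of z0 a] unfolding z0r D_def by simp
    also have "\<dots> \<le> D - (1 - r1\<^sup>2) * (1 - r1\<^sup>2)"
      using ar q by (intro diff_left_mono mult_left_mono) auto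
    also have "\<dots> \<le> D - (1 - r1\<^sup>2) * (1 - r1\<^sup>2) * (D / 4)"
      using D4 q by (intro diff_left_mono mult_left_le) auto
    also have "\<dots> = \<rho>\<^sup>2 * D"
    proof -
      have "\<rho>\<^sup>2 = 1 - (1 - r1\<^sup>2) * (1 - r1\<^sup>2) / 4" using qq by (simp add: \<rho>_def)
      moreover have "D - t * t * (D / 4) = (1 - t * t / 4) * D" for t :: real
        by (simp add: algebra_simps)
      ultimately show ?thesis by (simp only:)
    qed
    finally have "(cmod (z0 - a) / cmod (1 - z0 * cnj a))\<^sup>2 \<le> \<rho>\<^sup>2"
      using D0 unfolding power_divide D_def[symmetric] by (simp add: divide_le_eq)
    then show ?thesis
      unfolding norm_divide by (rule power2_le_imp_le) (use \<rho> in simp)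
  qed
  have "\<exists>(n::nat) e d. \<forall>z w. cmod z < 1 \<longrightarrow> cmod w < 1 \<longrightarrow> dBR_kernel b z w = (\<Sum>i<n. e i z * d i w)"
    by (rule dBR_kernel_finite_rank[where u = z0 and \<rho> = \<rho> and N = N])
       (fact b b1 bdry zeros z0 \<rho> N)+
  then obtain n :: nat and e d where "\<And>z w. cmod z < 1 \<Longrightarrow> cmod w < 1 \<Longrightarrow> dBR_kernel b z w = (\<Sum>i<n. e i z * d i w)"
    by metis
  then show ?thesis
    unfolding dBR_def
    by (intro rkhs_finite_rank_no_interpolation[where n = n and e = e and d = d])
       (auto simp: uncountable_infinite uncountable_ball)
qed

theorem theorem5p2:
  fixes m :: nat and \<mu> :: "nat \<Rightarrow> complex measure" and b :: "complex \<Rightarrow> complex"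
  assumes "m \<ge> 2"
    and "\<forall>j\<in>{1..m}. circle_measure (\<mu> j)"
    and "b holomorphic_on ball 0 1" and "\<forall>z\<in>ball 0 1. cmod (b z) \<le> 1"
    and "Hmu m \<mu> = dBR b"
  shows "\<forall>j\<in>{2..m}. \<mu> j = null_measure borel"
proof (rule ccontr)
  assume "\<not> ?thesis"
  then obtain j where j: "2 \<le> j" "j \<le> m" "\<mu> j \<noteq> null_measure borel" by auto
  have b1: "cmod (b z) \<le> 1" if "cmod z < 1" for z
    using assms(4) that by simp
  have growth: "\<exists>C\<ge>0. \<forall>w. cmod w < 1 \<longrightarrow> cmod (f w) \<le> C * (1 - cmod w) powr (-(1/4))"
    if "f \<in> dBR b" for f
  proof (rule Hmuj_growth)
    show "circle_measure (\<mu> j)" using assms(2) j by auto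
    show "f \<in> Hmuj (\<mu> j) j" using that j unfolding assms(5)[symmetric] Hmu_def by auto
  qed (use j in auto)
  obtain f where f: "f holomorphic_on UNIV" "f \<notin> dBR b"
    using dBR_misses_entire_function[OF assms(3) b1 boundary_modulus_one[OF assms(3) b1 growth]]
    by blast
  \<comment> \<open>The growth used one index \<open>j\<close>; here all indices enter, with zero
    and nonzero measures alike.\<close>
  have "f \<in> Hmu m \<mu>"
    unfolding Hmu_def using assms(2) by (auto intro!: entire_in_Hmuj[OF f(1)])
  with f(2) show False unfolding assms(5) by blast
qed

end
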